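(* Let $(\beta,B)\in\Theta_{11}$, i.e. $0<\beta<1$ and $B=0$, and let $(A_N)_{N\ge1}$ be a sequence of coupling matrices such that $\lim_{N\to\infty}\max_{1\le i\le N}R_i=1$. Set $\alpha_N:=\max_{1\le i\le N}\sum_{j=1}^NA_N(i,j)^2$. If $\boldsymbol\sigma$ is a random vector from the Ising model $\mathbb P$ with parameters $(A_N,\beta,0)$, then $$d_{KS}\Big(\sqrt N\,\overline{\boldsymbol\sigma},Z_\tau\Big)\lesssim\frac1{\sqrt N}+\frac{\lVert A_N\rVert_F^2\sqrt{\alpha_N\log N}}{\sqrt N}+\Big[1+\lVert A_N\rVert_F\,\alpha_N\log N\Big]\sqrt{\frac{\sum_{i=1}^N(R_i-1)^2}N},$$ where $Z_\tau\sim N(0,\tau)$ with $\tau=\frac1{1-\beta}$.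
   Context: A coupling matrix $A_N$ is a symmetric $N\times N$ matrix with non-negative entries and zeros on the diagonal. The Ising model with parameters $(A_N,\beta,B)$, $\beta>0$, $B\in\mathbb R$, is the probability mass function on $\boldsymbol\sigma=(\sigma_1,\dots,\sigma_N)\in\{-1,1\}^N$ given by $\mathbb P(\boldsymbol\sigma)=\frac1{Z_N(\beta,B)}\exp\big(\frac\beta2\boldsymbol\sigma^\top A_N\boldsymbol\sigma+B\sum_{i=1}^N\sigma_i\big)$. Put $\overline{\boldsymbol\sigma}=\frac1N\sum_{i=1}^N\sigma_i$, $R_i=\sum_{j=1}^NA_N(i,j)$, and $\lVert\cdot\rVert_F$ the Frobenius norm. $d_{KS}(X,Y)=\sup_{x\in\mathbb R}|\mathbb P(X\le x)-\mathbb P(Y\le x)|$. $x_N\lesssim y_N$ means there is a finite constant $C$ free of $N$ (it may depend on $\beta$ and on the sequence $(A_N)$) with $x_N\le Cy_N$ for all $N$. *)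

theory Defs
  imports "HOL-Probability.Probability"
begin

(* An N x N matrix is a function nat => nat => real of which only the entries with both
   indices in {1..N} are used. *)

definition coupling_matrix :: "nat \<Rightarrow> (nat \<Rightarrow> nat \<Rightarrow> real) \<Rightarrow> bool" where
  "coupling_matrix N A \<longleftrightarrow>
     (\<forall>i\<in>{1..N}. \<forall>j\<in>{1..N}. A i j = A j i \<and> A i j \<ge> 0) \<and> (\<forall>i\<in>{1..N}. A i i = 0)"

definition row_sum :: "nat \<Rightarrow> (nat \<Rightarrow> nat \<Rightarrow> real) \<Rightarrow> nat \<Rightarrow> real" where
  "row_sum N A i = (\<Sum>j=1..N. A i j)"

definition max_row_sq :: "nat \<Rightarrow> (nat \<Rightarrow> nat \<Rightarrow> real) \<Rightarrow> real" where
  "max_row_sq N A = (MAX i\<in>{1..N}. \<Sum>j=1..N. (A i j)\<^sup>2)"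

definition frobenius_norm :: "nat \<Rightarrow> (nat \<Rightarrow> nat \<Rightarrow> real) \<Rightarrow> real" where
  "frobenius_norm N A = sqrt (\<Sum>i=1..N. \<Sum>j=1..N. (A i j)\<^sup>2)"

definition spin_configs :: "nat \<Rightarrow> (nat \<Rightarrow> real) set" where
  "spin_configs N = {1..N} \<rightarrow>\<^sub>E {-1, 1}"

definition ising_weight ::
    "nat \<Rightarrow> (nat \<Rightarrow> nat \<Rightarrow> real) \<Rightarrow> real \<Rightarrow> real \<Rightarrow> (nat \<Rightarrow> real) \<Rightarrow> real" where
  "ising_weight N A \<beta> B \<sigma> =
     exp (\<beta> / 2 * (\<Sum>i=1..N. \<Sum>j=1..N. \<sigma> i * A i j * \<sigma> j) + B * (\<Sum>i=1..N. \<sigma> i))"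

definition ising_partition :: "nat \<Rightarrow> (nat \<Rightarrow> nat \<Rightarrow> real) \<Rightarrow> real \<Rightarrow> real \<Rightarrow> real" where
  "ising_partition N A \<beta> B = (\<Sum>\<sigma>\<in>spin_configs N. ising_weight N A \<beta> B \<sigma>)"

definition ising_pmf ::
    "nat \<Rightarrow> (nat \<Rightarrow> nat \<Rightarrow> real) \<Rightarrow> real \<Rightarrow> real \<Rightarrow> (nat \<Rightarrow> real) pmf" where
  "ising_pmf N A \<beta> B = embed_pmf (\<lambda>\<sigma>.
     if \<sigma> \<in> spin_configs N then ising_weight N A \<beta> B \<sigma> / ising_partition N A \<beta> B else 0)"

lemma finite_spin_configs [simp]: "finite (spin_configs N)"
  unfolding spin_configs_def by (intro finite_PiE) auto

lemma ising_partition_pos: "ising_partition N A \<beta> B > 0"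
proof -
  have "spin_configs N \<noteq> {}"
    unfolding spin_configs_def by (simp add: PiE_eq_empty_iff)
  then show ?thesis
    unfolding ising_partition_def by (intro sum_pos) (auto simp: ising_weight_def)
qed

(* The function passed to embed_pmf is a probability mass function, so that the definition
   of ising_pmf is meaningful. *)
lemma pmf_ising_pmf:
  "pmf (ising_pmf N A \<beta> B) \<sigma> =
     (if \<sigma> \<in> spin_configs N then ising_weight N A \<beta> B \<sigma> / ising_partition N A \<beta> B else 0)"
proof -
  let ?f = "\<lambda>\<sigma>. if \<sigma> \<in> spin_configs N
    then ising_weight N A \<beta> B \<sigma> / ising_partition N A \<beta> B else 0"
  have nn: "0 \<le> ?f \<sigma>" for \<sigma>
    using ising_partition_pos[of N A \<beta> B] by (simp add: ising_weight_def)
  have "(\<integral>\<^sup>+ \<sigma>. ennreal (?f \<sigma>) \<partial>count_space UNIV) = (\<Sum>\<sigma>\<in>spin_configs N. ennreal (?f \<sigma>))"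
    by (rule nn_integral_count_space') auto
  also have "\<dots> = ennreal (\<Sum>\<sigma>\<in>spin_configs N. ?f \<sigma>)"
    using nn by (intro sum_ennreal) blast
  also have "(\<Sum>\<sigma>\<in>spin_configs N. ?f \<sigma>) = 1"
    using ising_partition_pos[of N A \<beta> B]
    by (simp add: sum_divide_distrib[symmetric] ising_partition_def[symmetric])
  finally have "(\<integral>\<^sup>+ \<sigma>. ennreal (?f \<sigma>) \<partial>count_space UNIV) = 1" by simp
  then show ?thesis
    unfolding ising_pmf_def using nn by (subst pmf_embed_pmf) auto
qed

definition spin_mean :: "nat \<Rightarrow> (nat \<Rightarrow> real) \<Rightarrow> real" where
  "spin_mean N \<sigma> = (\<Sum>i=1..N. \<sigma> i) / real N"

definition normal_measure :: "real \<Rightarrow> real \<Rightarrow> real measure" where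
  "normal_measure \<mu> v = density lborel (\<lambda>x. ennreal (normal_density \<mu> (sqrt v) x))"

(* The Kolmogorov-Smirnov distance of two random variables, as a function of their laws;
   for laws on the reals the supremum ranges over a subset of [0, 1]. *)
definition d_KS :: "real measure \<Rightarrow> real measure \<Rightarrow> real" where
  "d_KS \<mu> \<nu> = (SUP x. \<bar>cdf \<mu> x - cdf \<nu> x\<bar>)"

end

theory Submission
  imports Defs
begin

text \<open>
  Let \<open>W\<close> be the normalized magnetization and \<open>t\<^sub>i = tanh (\<beta> m\<^sub>i)\<close> the conditional mean of the \<open>i\<close>-th
  spin given the others, where \<open>m\<^sub>i = \<Sum>\<^sub>j A\<^sub>i\<^sub>j \<sigma>\<^sub>j\<close>. Resampling the \<open>i\<close>-th spin gives
  \<open>E[(\<sigma>\<^sub>i - t\<^sub>i) g(\<sigma>)] = E[(1 - t\<^sub>i\<^sup>2) / 2 (g(\<sigma>\<^sup>i\<^sup>+) - g(\<sigma>\<^sup>i\<^sup>-))]\<close>. Take \<open>g = f(W)\<close> with \<open>f\<close> the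
  solution of the Stein equation of \<open>N(0, \<tau>)\<close> for the half line \<open>(-\<infinity>, z]\<close>, and sum over \<open>i\<close>.
  Since \<open>\<Sum>\<^sub>i t\<^sub>i \<approx> \<beta> \<Sum>\<^sub>i m\<^sub>i \<approx> \<beta> \<Sum>\<^sub>i \<sigma>\<^sub>i\<close>, this leaves three errors: the drift error, coming from
  \<open>R\<^sub>j - 1\<close> and from \<open>|\<beta> m\<^sub>i - t\<^sub>i| \<le> |m\<^sub>i|\<^sup>3\<close>; the variance error \<open>E[\<Sum>\<^sub>i t\<^sub>i\<^sup>2] / N\<close>; and a
  discretization error of order \<open>1 / \<surd>N\<close>, in which the jump of \<open>f'\<close> at \<open>z\<close> is handled by the same
  identity with \<open>g = 1{W \<le> z}\<close>.

  The moments of linear statistics come from Dobrushin's condition \<open>\<beta> max\<^sub>i R\<^sub>i < 1\<close>: the Glauber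
  dynamics contracts the vector of oscillations of an observable in Euclidean norm, so a centred
  observable with oscillations \<open>d\<close> has second and fourth moments of order \<open>\<parallel>d\<parallel>\<^sup>2\<close> and \<open>\<parallel>d\<parallel>\<^sup>4\<close>. The
  hypothesis on the row sums enters the variance error once more: unless the right-hand side is
  bounded below, some \<open>R\<^sub>i \<ge> 1/2\<close>, so \<open>\<alpha>\<^sub>N \<ge> 1 / (4 N)\<close> and \<open>1 / N \<le> 2 \<surd>(\<alpha>\<^sub>N / N)\<close>.
\<close>

section \<open>The Stein equation of a centred normal law\<close>

lemma real_distribution_normal_measure:
  assumes "0 < v"
  shows "real_distribution (normal_measure \<mu> v)"
  using prob_space_normal_density[of "sqrt v" \<mu>] assms
  by (auto simp: real_distribution_def real_distribution_axioms_def normal_measure_def)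

text \<open>Fundamental theorem of calculus. Anchoring the integral at \<open>x - 1\<close> keeps it
  over a compact interval and makes \<open>x\<close> an interior point, so the one-sided theorem on
  \<open>{x - 1..x + 1}\<close> yields a two-sided derivative.\<close>

lemma DERIV_cdf_normal_measure:
  assumes "0 < v"
  shows "(cdf (normal_measure \<mu> v) has_real_derivative normal_density \<mu> (sqrt v) x) (at x)"
proof -
  define M where "M = normal_measure \<mu> v"
  define \<phi> where "\<phi> = normal_density \<mu> (sqrt v)"
  interpret real_distribution M
    unfolding M_def by (rule real_distribution_normal_measure[OF assms])
  have [measurable]: "\<phi> \<in> borel_measurable borel"
    by (simp add: \<phi>_def)
  have int: "integrable lborel \<phi>"
    using assms by (simp add: \<phi>_def)
  have cont: "continuous_on S \<phi>" for S
    unfolding \<phi>_def normal_density_def by (intro continuous_intros) (use assms in auto)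
  have cdf_eq: "cdf M y = cdf M (x - 1) + integral {x - 1..y} \<phi>" if "x - 1 < y" for y
  proof -
    have "cdf M y - cdf M (x - 1) = measure M {x - 1<..y}"
      using that by (rule cdf_diff_eq)
    also have "\<dots> = (\<integral>t. indicator {x - 1<..y} t \<partial>M)"
      by simp
    also have "\<dots> = (\<integral>t. \<phi> t * indicator {x - 1<..y} t \<partial>lborel)"
      unfolding M_def normal_measure_def
      by (subst integral_density) (auto simp: \<phi>_def)
    also have "\<dots> = (LINT t:{x - 1<..y}|lborel. \<phi> t)"
      by (simp add: set_lebesgue_integral_def mult.commute)
    also have "\<dots> = integral {x - 1<..y} \<phi>"
      by (rule set_borel_integral_eq_integral)
        (use integrable_mult_indicator[OF _ int, of "{x - 1<..y}"] in \<open>simp add: set_integrable_def\<close>)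
    also have "\<dots> = integral {x - 1..y} \<phi>"
      by (rule integral_spike_set; rule negligible_subset[of "{x - 1}"]) auto
    finally show ?thesis by simp
  qed
  have "((\<lambda>y. integral {x - 1..y} \<phi>) has_real_derivative \<phi> x) (at x within {x - 1..x + 1})"
    by (rule integral_has_real_derivative) (auto simp: cont)
  then have "((\<lambda>y. cdf M (x - 1) + integral {x - 1..y} \<phi>) has_real_derivative \<phi> x) (at x)"
    by (auto simp: at_within_Icc_at intro!: derivative_eq_intros)
  then have "(cdf M has_real_derivative \<phi> x) (at x)"
  proof (rule has_field_derivative_transform_within_open)
    show "open {x - 1<..}" "x \<in> {x - 1<..}" by auto
  qed (simp add: cdf_eq)
  then show ?thesis by (simp add: M_def \<phi>_def)
qed

lemma DERIV_normal_density:
  assumes "0 < v"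
  shows "(normal_density \<mu> (sqrt v) has_real_derivative
    - ((x - \<mu>) / v * normal_density \<mu> (sqrt v) x)) (at x)"
  unfolding normal_density_def
  by (rule derivative_eq_intros refl | use assms in \<open>simp add: field_simps\<close>)+

lemma normal_density_tendsto_0:
  assumes "0 < v"
  shows "(normal_density 0 (sqrt v) \<longlongrightarrow> 0) at_top"
    and "(normal_density 0 (sqrt v) \<longlongrightarrow> 0) at_bot"
  unfolding normal_density_def using assms by real_asymp+

text \<open>Mills ratio bound. In the derivative of \<open>G\<close> the density terms cancel and
  only - v / y^2 * \<phi> y remains, so \<open>G\<close> decreases on the positive half line; its
  limit at infinity is 0, hence it is non-negative.\<close>

lemma normal_upper_tail_le:
  assumes "0 < v" "0 < x"
  shows "x / v * (1 - cdf (normal_measure 0 v) x) \<le> normal_density 0 (sqrt v) x"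
proof -
  define F where "F = cdf (normal_measure 0 v)"
  define \<phi> where "\<phi> = normal_density 0 (sqrt v)"
  interpret real_distribution "normal_measure 0 v"
    by (rule real_distribution_normal_measure[OF assms(1)])
  have pos: "\<phi> y > 0" for y
    using assms by (simp add: \<phi>_def normal_density_pos)
  have DF: "(F has_real_derivative \<phi> y) (at y)" for y
    unfolding F_def \<phi>_def by (rule DERIV_cdf_normal_measure[OF assms(1)])
  have D\<phi>: "(\<phi> has_real_derivative - (y / v * \<phi> y)) (at y)" for y
    unfolding \<phi>_def using DERIV_normal_density[OF assms(1), of 0 y] by simp
  define G where "G y = v / y * \<phi> y - (1 - F y)" for y
  have DG: "(G has_real_derivative - (v / y\<^sup>2 * \<phi> y)) (at y)" if "y > 0" for y
    unfolding G_def
    by (rule derivative_eq_intros DF D\<phi> refl | use that assms in \<open>simp add: field_simps power2_eq_square\<close>)+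
  have "((\<lambda>y. v / y * \<phi> y - (1 - F y)) \<longlongrightarrow> 0 * 0 - (1 - 1)) at_top"
    unfolding \<phi>_def F_def
    by (intro tendsto_intros normal_density_tendsto_0 assms cdf_lim_at_top_prob) real_asymp
  then have lim: "(G \<longlongrightarrow> 0) at_top" by (simp add: G_def[abs_def])
  have "eventually (\<lambda>y. G y \<le> G x) at_top"
    using eventually_ge_at_top[of x]
  proof eventually_elim
    case (elim y)
    have "\<exists>D. (G has_real_derivative D) (at t) \<and> D \<le> 0" if "x \<le> t" for t
      using DG[of t] pos[of t] assms that by (intro exI[of _ "- (v / t\<^sup>2 * \<phi> t)"]) auto
    then show ?case
      by (intro DERIV_nonpos_imp_nonincreasing[OF elim])
  qed
  then have "0 \<le> G x"
    by (rule tendsto_upperbound[OF lim]) simp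
  then show ?thesis
    using assms by (simp add: G_def F_def \<phi>_def field_simps)
qed

text \<open>Mirror image of the upper tail: here \<open>G\<close> increases on the negative half
  line, starting from the limit 0 at minus infinity.\<close>

lemma normal_lower_tail_le:
  assumes "0 < v" "x < 0"
  shows "- x / v * cdf (normal_measure 0 v) x \<le> normal_density 0 (sqrt v) x"
proof -
  define F where "F = cdf (normal_measure 0 v)"
  define \<phi> where "\<phi> = normal_density 0 (sqrt v)"
  interpret real_distribution "normal_measure 0 v"
    by (rule real_distribution_normal_measure[OF assms(1)])
  have pos: "\<phi> y > 0" for y
    using assms by (simp add: \<phi>_def normal_density_pos)
  have DF: "(F has_real_derivative \<phi> y) (at y)" for y
    unfolding F_def \<phi>_def by (rule DERIV_cdf_normal_measure[OF assms(1)])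
  have D\<phi>: "(\<phi> has_real_derivative - (y / v * \<phi> y)) (at y)" for y
    unfolding \<phi>_def using DERIV_normal_density[OF assms(1), of 0 y] by simp
  define G where "G y = - (v / y * \<phi> y) - F y" for y
  have DG: "(G has_real_derivative v / y\<^sup>2 * \<phi> y) (at y)" if "y < 0" for y
    unfolding G_def
    by (rule derivative_eq_intros DF D\<phi> refl | use that assms in \<open>simp add: field_simps power2_eq_square\<close>)+
  have "((\<lambda>y. - (v / y * \<phi> y) - F y) \<longlongrightarrow> - (0 * 0) - 0) at_bot"
    unfolding \<phi>_def F_def
    by (intro tendsto_intros normal_density_tendsto_0 assms cdf_lim_at_bot) real_asymp
  then have lim: "(G \<longlongrightarrow> 0) at_bot" by (simp add: G_def[abs_def])
  have "eventually (\<lambda>y. G y \<le> G x) at_bot"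
    using eventually_le_at_bot[of x]
  proof eventually_elim
    case (elim y)
    have "\<exists>D. (G has_real_derivative D) (at t) \<and> 0 \<le> D" if "t \<le> x" for t
      using DG[of t] pos[of t] assms that by (intro exI[of _ "v / t\<^sup>2 * \<phi> t"]) auto
    then show ?case
      by (intro DERIV_nonneg_imp_nondecreasing[OF elim])
  qed
  then have "0 \<le> G x"
    by (rule tendsto_upperbound[OF lim]) simp
  then show ?thesis
    using assms by (simp add: G_def F_def \<phi>_def field_simps)
qed

section \<open>The bounded solution of f'(x) - x f(x) / v = 1{x <= z} - F(z), with F the normal
  distribution function\<close>

definition stein_solution :: "real \<Rightarrow> real \<Rightarrow> real \<Rightarrow> real" where
  "stein_solution v z x =
     (if x \<le> z then cdf (normal_measure 0 v) x * (1 - cdf (normal_measure 0 v) z)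
      else cdf (normal_measure 0 v) z * (1 - cdf (normal_measure 0 v) x))
     / normal_density 0 (sqrt v) x"

text \<open>In either branch the numerator is at most \<open>F x\<close> and at most
  \<open>1 - F x\<close>, by monotonicity of \<open>F\<close> on the two sides of \<open>z\<close>.
  The Mills ratio bounds then control \<open>x / v * f x\<close>, using \<open>1 - F x\<close> for
  positive and \<open>F x\<close> for negative \<open>x\<close>.\<close>

lemma stein_solution_bounds:
  assumes "0 < v"
  shows "0 \<le> stein_solution v z x"
    and "stein_solution v z x \<le> v + 1 / normal_density 0 (sqrt v) 1"
    and "\<bar>x / v * stein_solution v z x\<bar> \<le> 1"
proof -
  define F where "F = cdf (normal_measure 0 v)"
  define \<phi> where "\<phi> = normal_density 0 (sqrt v)"
  define f where "f = stein_solution v z"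
  interpret real_distribution "normal_measure 0 v"
    by (rule real_distribution_normal_measure[OF assms(1)])
  have pos: "\<phi> y > 0" for y
    using assms by (simp add: \<phi>_def normal_density_pos)
  have F: "0 \<le> F y" "F y \<le> 1" "y \<le> y' \<Longrightarrow> F y \<le> F y'" for y y'
    using cdf_nonneg cdf_bounded_prob cdf_nondecreasing by (auto simp: F_def)
  have f_eq: "f x = (if x \<le> z then F x * (1 - F z) else F z * (1 - F x)) / \<phi> x"
    by (simp add: f_def stein_solution_def F_def \<phi>_def)
  show nonneg: "0 \<le> stein_solution v z x"
    unfolding f_def[symmetric] f_eq using pos[of x] F by (simp add: less_imp_le)
  have "F x * (1 - F z) \<le> 1 - F z" "F x * (1 - F z) \<le> F x"
    "F z * (1 - F x) \<le> 1 - F x" "F z * (1 - F x) \<le> F z"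
    using F(1,2) by (simp_all add: mult_left_le_one_le mult_left_le)
  then have up: "\<phi> x * f x \<le> 1 - F x" and lo: "\<phi> x * f x \<le> F x"
    using pos[of x] F(3)[of x z] F(3)[of z x] by (auto simp: f_eq)
  have pos_side: "x / v * f x \<le> 1" if "x > 0"
  proof -
    have "x / v * (\<phi> x * f x) \<le> x / v * (1 - F x)"
      using up that assms by (intro mult_left_mono) auto
    also have "\<dots> \<le> \<phi> x"
      unfolding F_def \<phi>_def by (rule normal_upper_tail_le[OF assms that])
    finally have "\<phi> x * (x / v * f x) \<le> \<phi> x * 1" by (simp add: algebra_simps)
    then show ?thesis using pos[of x] by (simp only: mult_le_cancel_left_pos)
  qed
  have neg_side: "- x / v * f x \<le> 1" if "x < 0"
  proof -
    have "- x / v * (\<phi> x * f x) \<le> - x / v * F x"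
      using lo that assms by (intro mult_left_mono) (auto simp: divide_nonpos_pos)
    also have "\<dots> \<le> \<phi> x"
      unfolding F_def \<phi>_def by (rule normal_lower_tail_le[OF assms that])
    finally have "\<phi> x * (- x / v * f x) \<le> \<phi> x * 1" by (simp add: algebra_simps)
    then show ?thesis using pos[of x] by (simp only: mult_le_cancel_left_pos)
  qed
  have abs_eq: "\<bar>x / v * f x\<bar> = \<bar>x\<bar> / v * f x"
    using nonneg assms by (simp add: f_def abs_mult)
  show xf: "\<bar>x / v * stein_solution v z x\<bar> \<le> 1"
    unfolding f_def[symmetric] abs_eq using pos_side neg_side
    by (cases x "0::real" rule: linorder_cases) auto
  \<comment> \<open>Where |x| <= 1 the density is at least its value at 1. Elsewhere |x| > 1, and
    the bound on \<open>x / v * f x\<close> already gives \<open>f x \<le> v\<close>.\<close>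
  show "stein_solution v z x \<le> v + 1 / normal_density 0 (sqrt v) 1"
  proof (cases "\<bar>x\<bar> \<le> 1")
    case True
    have "\<phi> 1 \<le> \<phi> x"
      using True assms
      by (auto simp: \<phi>_def normal_density_def divide_simps abs_le_square_iff[of x 1, simplified])
    then have "\<phi> 1 * f x \<le> 1"
      using up F(1)[of x] nonneg[folded f_def] mult_right_mono[of "\<phi> 1" "\<phi> x" "f x"] by linarith
    then have "f x \<le> 1 / \<phi> 1"
      using pos[of 1] by (simp add: field_simps)
    then show ?thesis using assms by (simp add: f_def \<phi>_def)
  next
    case False
    have "1 * f x \<le> \<bar>x\<bar> * f x"
      using False nonneg by (intro mult_right_mono) (auto simp: f_def)
    also have "\<dots> \<le> v"
      using xf assms unfolding f_def[symmetric] abs_eq by (simp add: field_simps)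
    finally show ?thesis using pos[of 1] by (simp add: f_def \<phi>_def add_increasing2)
  qed
qed

text \<open>The solution has a kink at \<open>z\<close>, so the mean value theorem is applied only
  on intervals lying on one side of it. The factor is the derivative at \<xi> as prescribed by the
  Stein equation.\<close>

lemma stein_solution_mvt:
  assumes "0 < v" "x < y" "y \<le> z \<or> z < x"
  shows "\<exists>\<xi>. x < \<xi> \<and> \<xi> < y \<and> stein_solution v z y - stein_solution v z x =
    (y - x) * (\<xi> / v * stein_solution v z \<xi> + of_bool (y \<le> z) - cdf (normal_measure 0 v) z)"
proof -
  define F where "F = cdf (normal_measure 0 v)"
  define \<phi> where "\<phi> = normal_density 0 (sqrt v)"
  have pos: "\<phi> y > 0" for y
    using assms by (simp add: \<phi>_def normal_density_pos)
  have DF: "(F has_real_derivative \<phi> y) (at y)" for y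
    unfolding F_def \<phi>_def by (rule DERIV_cdf_normal_measure[OF assms(1)])
  have D\<phi>: "(\<phi> has_real_derivative - (y / v * \<phi> y)) (at y)" for y
    unfolding \<phi>_def using DERIV_normal_density[OF assms(1), of 0 y] by simp
  \<comment> \<open>The branch is frozen by the position of \<open>y\<close>; the resulting function
    is smooth on the whole line and agrees with the solution on \<open>{x..y}\<close>.\<close>
  define g where "g t = (if y \<le> z then F t * (1 - F z) else F z * (1 - F t)) / \<phi> t" for t
  have g: "stein_solution v z t = g t" if "x \<le> t" "t \<le> y" for t
    using that assms by (auto simp: stein_solution_def g_def F_def \<phi>_def)
  have Dg: "(g has_real_derivative t / v * g t + of_bool (y \<le> z) - F z) (at t)" for t
  proof (cases "y \<le> z")
    case True
    have "((\<lambda>t. F t * (1 - F z) / \<phi> t) has_real_derivative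
        t / v * (F t * (1 - F z) / \<phi> t) + 1 - F z) (at t)"
      by (rule derivative_eq_intros DF D\<phi> refl
          | use pos[of t] assms(1) in \<open>simp add: field_simps power2_eq_square\<close>)+
    then show ?thesis using True by (simp add: g_def[abs_def])
  next
    case False
    have "((\<lambda>t. F z * (1 - F t) / \<phi> t) has_real_derivative
        t / v * (F z * (1 - F t) / \<phi> t) - F z) (at t)"
      by (rule derivative_eq_intros DF D\<phi> refl
          | use pos[of t] assms(1) in \<open>simp add: field_simps power2_eq_square\<close>)+
    then show ?thesis using False by (simp add: g_def[abs_def])
  qed
  obtain \<xi> where "x < \<xi>" "\<xi> < y" "g y - g x = (y - x) * (\<xi> / v * g \<xi> + of_bool (y \<le> z) - F z)"
    using MVT2[OF assms(2), of g, OF Dg] by blast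
  then show ?thesis
    using assms(2) by (intro exI[of _ \<xi>]) (auto simp: g F_def)
qed

lemma continuous_stein_solution:
  assumes "0 < v"
  shows "continuous_on UNIV (stein_solution v z)"
proof -
  have F: "continuous_on S (cdf (normal_measure 0 v))" for S
    by (intro DERIV_atLeastAtMost_imp_continuous_on continuous_at_imp_continuous_on)
      (use DERIV_cdf_normal_measure[OF assms] DERIV_isCont in blast)
  have \<phi>: "continuous_on S (normal_density 0 (sqrt v))" for S
    by (intro continuous_at_imp_continuous_on)
      (use DERIV_normal_density[OF assms] DERIV_isCont in blast)
  have "normal_density 0 (sqrt v) x \<noteq> 0" for x
    using normal_density_pos[of "sqrt v" 0 x] assms by auto
  moreover have "continuous_on UNIV (\<lambda>x. if x \<le> z
      then cdf (normal_measure 0 v) x * (1 - cdf (normal_measure 0 v) z)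
      else cdf (normal_measure 0 v) z * (1 - cdf (normal_measure 0 v) x))"
    by (intro continuous_on_cases_le[where h = id and a = z, simplified] continuous_intros F) (auto intro!: continuous_intros F)
  ultimately show ?thesis
    unfolding stein_solution_def[abs_def] by (intro continuous_intros \<phi>) auto
qed

text \<open>Off the kink the derivative is at most 2 in absolute value: 1 from
  \<open>x / v * f x\<close> and 1 from the difference of the indicator and the probability. An
  interval across \<open>z\<close> is split there.\<close>

lemma stein_solution_lipschitz:
  assumes "0 < v"
  shows "\<bar>stein_solution v z y - stein_solution v z x\<bar> \<le> 2 * \<bar>y - x\<bar>"
proof -
  define f where "f = stein_solution v z"
  interpret real_distribution "normal_measure 0 v"
    by (rule real_distribution_normal_measure[OF assms(1)])
  have bool01: "0 \<le> (of_bool P :: real)" "(of_bool P :: real) \<le> 1" for P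
    by auto
  have side: "\<bar>f b - f a\<bar> \<le> 2 * (b - a)" if ab: "a < b" "b \<le> z \<or> z < a" for a b
  proof -
    obtain \<xi> where \<xi>: "f b - f a =
        (b - a) * (\<xi> / v * f \<xi> + of_bool (b \<le> z) - cdf (normal_measure 0 v) z)"
      using stein_solution_mvt[OF assms ab] unfolding f_def by blast
    have "\<bar>\<xi> / v * f \<xi> + of_bool (b \<le> z) - cdf (normal_measure 0 v) z\<bar> \<le> 2"
      using stein_solution_bounds(3)[OF assms, of \<xi> z] cdf_nonneg[of z] cdf_bounded_prob[of z]
        bool01[of "b \<le> z"]
      unfolding f_def by linarith
    then have "(b - a) * \<bar>\<xi> / v * f \<xi> + of_bool (b \<le> z) - cdf (normal_measure 0 v) z\<bar> \<le> (b - a) * 2"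
      using ab(1) by (intro mult_left_mono) auto
    moreover have "\<bar>b - a\<bar> = b - a" using ab(1) by simp
    ultimately show ?thesis
      unfolding \<xi> abs_mult by (simp only: mult.commute)
  qed
  \<comment> \<open>The one-sided mean value theorem requires \<open>z < a\<close>, so the left
    endpoint \<open>z\<close> is reached as the limit of \<open>a\<close> from the right, by
    continuity.\<close>
  have right: "\<bar>f b - f z\<bar> \<le> 2 * (b - z)" if "z < b" for b
  proof -
    have lim: "((\<lambda>a. 2 * (b - a) - \<bar>f b - f a\<bar>) \<longlongrightarrow> 2 * (b - z) - \<bar>f b - f z\<bar>) (at_right z)"
      by (intro tendsto_intros)
        (use continuous_stein_solution[OF assms, of z] in
          \<open>auto simp: f_def continuous_on_eq_continuous_at continuous_at_imp_continuous_at_within intro: tendsto_within_subset simp: isCont_def\<close>)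
    have "0 \<le> 2 * (b - z) - \<bar>f b - f z\<bar>"
      by (rule tendsto_lowerbound[OF lim])
        (use that side in \<open>auto intro!: eventually_at_rightI[of z b]\<close>)
    then show ?thesis by simp
  qed
  have "\<bar>f b - f a\<bar> \<le> 2 * (b - a)" if "a < b" for a b
  proof (cases "a \<le> z \<and> z < b")
    case True
    then have "\<bar>f z - f a\<bar> \<le> 2 * (z - a)"
      using side[of a z] by (cases "a = z") auto
    then show ?thesis using right[OF conjunct2[OF True]] by argo
  qed (use side that in force)
  from this[of x y] this[of y x] show ?thesis
    by (cases x y rule: linorder_cases) (auto simp: f_def)
qed

text \<open>First-order expansion around a point \<open>w\<close> of \<open>{u..y}\<close>. If the
  interval crosses \<open>z\<close>, the derivative jumps and only the crude bound 4 * (y - u) is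
  available, which the indicator difference, then equal to 1, absorbs. Otherwise the derivative is
  compared at two points of the interval, giving a quadratic error. The lower bound on
  \<open>L\<close> collects both constants.\<close>

lemma stein_solution_increment:
  assumes v: "0 < v" and "u \<le> w" "w \<le> y"
    and L: "4 + 2 / v + (v + 1 / normal_density 0 (sqrt v) 1) / v \<le> L"
  shows "\<bar>stein_solution v z y - stein_solution v z u
      - (y - u) * (w / v * stein_solution v z w + of_bool (w \<le> z) - cdf (normal_measure 0 v) z)\<bar>
    \<le> L * (y - u) * ((1 + \<bar>w\<bar>) * (y - u) + (of_bool (u \<le> z) - of_bool (y \<le> z)))"
proof -
  define f where "f = stein_solution v z"
  define p where "p = cdf (normal_measure 0 v) z"
  define d where "d = y - u"
  define M where "M = v + 1 / normal_density 0 (sqrt v) 1"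
  interpret real_distribution "normal_measure 0 v"
    by (rule real_distribution_normal_measure[OF v])
  have M: "0 \<le> M" using v by (simp add: M_def)
  have L': "4 + 2 / v + M / v \<le> L" using L by (simp add: M_def)
  have L4: "4 \<le> L" "0 \<le> L" and L2: "2 / v + M / v \<le> L"
    using L' M v divide_nonneg_pos[of M v] divide_nonneg_pos[of 2 v] by linarith+
  have d: "0 \<le> d" using assms by (simp add: d_def)
  have bool01: "0 \<le> (of_bool P :: real)" "(of_bool P :: real) \<le> 1" for P
    by auto
  have p: "0 \<le> p" "p \<le> 1"
    using cdf_nonneg cdf_bounded_prob by (auto simp: p_def)
  have fb: "0 \<le> f x" "f x \<le> M" "\<bar>x / v * f x\<bar> \<le> 1" for x
    using stein_solution_bounds[OF v, where x = x and z = z] by (auto simp: f_def M_def)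
  have lip: "\<bar>f b - f a\<bar> \<le> 2 * \<bar>b - a\<bar>" for a b
    unfolding f_def by (rule stein_solution_lipschitz[OF v])
  have "\<bar>f y - f u - d * (w / v * f w + of_bool (w \<le> z) - p)\<bar>
    \<le> L * d * ((1 + \<bar>w\<bar>) * d + (of_bool (u \<le> z) - of_bool (y \<le> z)))"
  proof (cases "d = 0")
    case True
    then show ?thesis by (auto simp: d_def)
  next
    case False
    then have "u < y" using d by (simp add: d_def)
    show ?thesis
    proof (cases "u \<le> z \<and> z < y")
      case True
      have "\<bar>w / v * f w + of_bool (w \<le> z) - p\<bar> \<le> 2"
        using fb(3)[of w] p bool01[of "w \<le> z"] by linarith
      then have "\<bar>d * (w / v * f w + of_bool (w \<le> z) - p)\<bar> \<le> 2 * d"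
        using d by (simp add: abs_mult mult.commute mult_left_mono)
      moreover have "\<bar>f y - f u\<bar> \<le> 2 * d"
        using lip[of y u] d by (simp add: d_def)
      ultimately have "\<bar>f y - f u - d * (w / v * f w + of_bool (w \<le> z) - p)\<bar> \<le> 4 * d"
        using abs_triangle_ineq4[of "f y - f u" "d * (w / v * f w + of_bool (w \<le> z) - p)"]
        by argo
      also have "\<dots> \<le> L * d * ((1 + \<bar>w\<bar>) * d + 1)"
      proof -
        have "L * d * 1 \<le> L * d * ((1 + \<bar>w\<bar>) * d + 1)"
          using L4 d by (intro mult_left_mono) auto
        moreover have "4 * d \<le> L * d" using L4 d by (intro mult_right_mono)
        ultimately show ?thesis by simp
      qed
      finally show ?thesis using True by simp
    next
      case same_side: False
      then obtain \<xi> where \<xi>: "u < \<xi>" "\<xi> < y" "f y - f u = d * (\<xi> / v * f \<xi> + of_bool (y \<le> z) - p)"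
        using stein_solution_mvt[OF v \<open>u < y\<close>, of z] by (force simp: f_def d_def p_def)
      have bool: "of_bool (w \<le> z) = (of_bool (y \<le> z) :: real)" "of_bool (u \<le> z) = (of_bool (y \<le> z) :: real)"
        using same_side assms \<open>u < y\<close> by auto
      have near: "\<bar>\<xi> - w\<bar> \<le> d" using \<xi> assms by (auto simp: d_def)
      \<comment> \<open>Discrete product rule: the first term is controlled by the Lipschitz
        constant 2, the second by the bound \<open>M\<close> on the solution.\<close>
      have "\<bar>\<xi> / v * f \<xi> - w / v * f w\<bar> = \<bar>w * (f \<xi> - f w) + (\<xi> - w) * f \<xi>\<bar> / v"
        using v by (simp add: field_simps flip: abs_div_pos)
      also have "\<dots> \<le> (\<bar>w\<bar> * (2 * d) + d * M) / v"
      proof (intro divide_right_mono order_trans[OF abs_triangle_ineq] add_mono)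
        show "\<bar>w * (f \<xi> - f w)\<bar> \<le> \<bar>w\<bar> * (2 * d)"
          using lip[of \<xi> w] near by (simp add: abs_mult mult_left_mono)
        show "\<bar>(\<xi> - w) * f \<xi>\<bar> \<le> d * M"
          using near fb[of \<xi>] d by (simp add: abs_mult mult_mono)
      qed (use v in auto)
      also have "\<dots> \<le> (2 / v + M / v) * ((1 + \<bar>w\<bar>) * d)"
      proof -
        have "(2 / v + M / v) * ((1 + \<bar>w\<bar>) * d) - (\<bar>w\<bar> * (2 * d) + d * M) / v
          = 2 / v * d + M / v * (\<bar>w\<bar> * d)"
          by (simp add: algebra_simps add_divide_distrib)
        moreover have "0 \<le> 2 / v * d" "0 \<le> M / v * (\<bar>w\<bar> * d)"
          using d v M by auto
        ultimately show ?thesis by argo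
      qed
      also have "\<dots> \<le> L * ((1 + \<bar>w\<bar>) * d)"
        using L2 d by (intro mult_right_mono) auto
      finally have "d * \<bar>\<xi> / v * f \<xi> - w / v * f w\<bar> \<le> d * (L * ((1 + \<bar>w\<bar>) * d))"
        using d by (rule mult_left_mono)
      moreover have "f y - f u - d * (w / v * f w + of_bool (w \<le> z) - p)
          = d * (\<xi> / v * f \<xi> - w / v * f w)"
        unfolding \<xi>(3) bool by (simp add: algebra_simps)
      ultimately show ?thesis
        using d unfolding bool by (simp add: abs_mult mult_ac)
    qed
  qed
  then show ?thesis by (simp add: f_def p_def d_def)
qed

section \<open>Moment bounds under Dobrushin's condition\<close>

lemma spin_configs_update:
  assumes "\<sigma> \<in> spin_configs N" "i \<in> {1..N}" "s = 1 \<or> s = -1"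
  shows "\<sigma>(i := s) \<in> spin_configs N"
  using assms by (auto simp: spin_configs_def PiE_def Pi_def extensional_def)

lemma spin_configs_cases:
  assumes "\<sigma> \<in> spin_configs N" "i \<in> {1..N}"
  obtains "\<sigma> i = 1" "\<sigma>(i := 1) = \<sigma>" | "\<sigma> i = -1" "\<sigma>(i := -1) = \<sigma>"
proof -
  have "\<sigma> i \<in> {-1, 1}"
    using assms unfolding spin_configs_def by blast
  with that show ?thesis
    by (metis fun_upd_triv insert_iff singletonD)
qed

text \<open>Flipping spin \<open>i\<close> is an involution of the configurations. Pairing each
  configuration with its flip reduces identities for resampling to a check on two points.\<close>

lemma sum_spin_configs_pair:
  fixes g :: "(nat \<Rightarrow> real) \<Rightarrow> real"
  assumes i: "i \<in> {1..N}"
  shows "(\<Sum>\<sigma>\<in>spin_configs N. g \<sigma>) = (\<Sum>\<sigma>\<in>spin_configs N. (g (\<sigma>(i := 1)) + g (\<sigma>(i := -1))) / 2)"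
proof -
  define flip where "flip \<sigma> = \<sigma>(i := - \<sigma> i)" for \<sigma> :: "nat \<Rightarrow> real"
  have mem: "flip \<sigma> \<in> spin_configs N" if "\<sigma> \<in> spin_configs N" for \<sigma>
    using spin_configs_cases[OF that i] spin_configs_update[OF that i] by (metis flip_def minus_minus)
  have "bij_betw flip (spin_configs N) (spin_configs N)"
    by (rule bij_betw_byWitness[where f' = flip]) (use mem in \<open>auto simp: flip_def\<close>)
  then have "(\<Sum>\<sigma>\<in>spin_configs N. g \<sigma>) = (\<Sum>\<sigma>\<in>spin_configs N. g (flip \<sigma>))"
    by (rule sum.reindex_bij_betw[symmetric])
  then have "(\<Sum>\<sigma>\<in>spin_configs N. g \<sigma>) = (\<Sum>\<sigma>\<in>spin_configs N. (g \<sigma> + g (flip \<sigma>)) / 2)"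
    by (simp add: sum.distrib flip: sum_divide_distrib)
  also have "\<dots> = (\<Sum>\<sigma>\<in>spin_configs N. (g (\<sigma>(i := 1)) + g (\<sigma>(i := -1))) / 2)"
  proof (rule sum.cong)
    fix \<sigma> assume "\<sigma> \<in> spin_configs N"
    then show "(g \<sigma> + g (flip \<sigma>)) / 2 = (g (\<sigma>(i := 1)) + g (\<sigma>(i := -1))) / 2"
      by (rule spin_configs_cases[OF _ i]) (simp_all add: flip_def)
  qed simp
  finally show ?thesis .
qed

lemma tanh_real_lipschitz: "\<bar>tanh y - tanh x\<bar> \<le> \<bar>y - x\<bar>" for x y :: real
proof -
  have D: "(tanh has_real_derivative 1 - (tanh x)\<^sup>2) (at x)" for x :: real
    by (auto intro!: derivative_eq_intros)
  have *: "\<bar>tanh b - tanh a\<bar> \<le> b - a" if ab: "a < b" for a b :: real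
  proof -
    obtain \<xi> where \<xi>: "tanh b - tanh a = (b - a) * (1 - (tanh \<xi>)\<^sup>2)"
      using MVT2[OF ab D] by auto
    have "0 \<le> 1 - (tanh \<xi>)\<^sup>2" "1 - (tanh \<xi>)\<^sup>2 \<le> 1"
      using tanh_real_bounds[of \<xi>] by (auto simp: abs_square_le_1 abs_le_iff)
    then show ?thesis
      using ab by (simp add: \<xi> abs_mult mult_left_le)
  qed
  show ?thesis
    using *[of x y] *[of y x] by (cases x y rule: linorder_cases) auto
qed

text \<open>The derivative of x - tanh x is tanh^2 x, which is at most x^2, so the mean value
  theorem from 0 gives the cube for x >= 0. Oddness covers negative x.\<close>

lemma abs_tanh_diff_le_cube: "\<bar>x - tanh x\<bar> \<le> \<bar>x\<bar> ^ 3" for x :: real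
proof -
  have D: "((\<lambda>x. x - tanh x) has_real_derivative (tanh x)\<^sup>2) (at x)" for x :: real
    by (auto intro!: derivative_eq_intros)
  have nonneg: "0 \<le> x - tanh x \<and> x - tanh x \<le> x ^ 3" if x: "0 \<le> x" for x :: real
  proof (cases "x = 0")
    case False
    obtain \<xi> where \<xi>: "0 < \<xi>" "\<xi> < x" "x - tanh x = x * (tanh \<xi>)\<^sup>2"
      using MVT2[of 0 x "\<lambda>x. x - tanh x", OF _ D] x False by fastforce
    have "\<bar>tanh \<xi>\<bar> \<le> \<bar>x\<bar>" using tanh_real_lipschitz[of \<xi> 0] \<xi> by simp
    then have "(tanh \<xi>)\<^sup>2 \<le> x\<^sup>2" by (simp add: abs_le_square_iff)
    then show ?thesis
      using \<xi> x by (simp add: power3_eq_cube power2_eq_square mult_left_mono)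
  qed simp
  show ?thesis
    using nonneg[of x] nonneg[of "- x"] by (cases "0 \<le> x") auto
qed

section \<open>The Ising model at zero field, its expectation and single-site resampling\<close>

locale subcritical_ising =
  fixes N :: nat and A :: "nat \<Rightarrow> nat \<Rightarrow> real" and \<beta> \<rho> :: real
  assumes N_pos: "1 \<le> N"
    and coupling: "coupling_matrix N A"
    and beta_pos: "0 < \<beta>"
    and row_sum_le: "i \<in> {1..N} \<Longrightarrow> row_sum N A i \<le> \<rho>"
    and subcritical: "\<beta> * \<rho> < 1"
begin

definition prob :: "(nat \<Rightarrow> real) \<Rightarrow> real" where
  "prob \<sigma> = ising_weight N A \<beta> 0 \<sigma> / ising_partition N A \<beta> 0"

definition expect :: "((nat \<Rightarrow> real) \<Rightarrow> real) \<Rightarrow> real" where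
  "expect f = (\<Sum>\<sigma>\<in>spin_configs N. prob \<sigma> * f \<sigma>)"

definition local_field :: "nat \<Rightarrow> (nat \<Rightarrow> real) \<Rightarrow> real" where
  "local_field i \<sigma> = (\<Sum>j=1..N. A i j * \<sigma> j)"

definition cond_mean :: "nat \<Rightarrow> (nat \<Rightarrow> real) \<Rightarrow> real" where
  "cond_mean i \<sigma> = tanh (\<beta> * local_field i \<sigma>)"

text \<open>The weights are the conditional probabilities of the two values of spin \<open>i\<close>
  given the other spins, so this is the conditional expectation of \<open>f\<close> given those
  spins.\<close>

definition resample :: "nat \<Rightarrow> ((nat \<Rightarrow> real) \<Rightarrow> real) \<Rightarrow> (nat \<Rightarrow> real) \<Rightarrow> real" where
  "resample i f \<sigma> = (1 + cond_mean i \<sigma>) / 2 * f (\<sigma>(i := 1)) + (1 - cond_mean i \<sigma>) / 2 * f (\<sigma>(i := -1))"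

definition glauber :: "((nat \<Rightarrow> real) \<Rightarrow> real) \<Rightarrow> (nat \<Rightarrow> real) \<Rightarrow> real" where
  "glauber f \<sigma> = (\<Sum>i=1..N. resample i f \<sigma>) / real N"

text \<open>A predicate on upper bounds instead of the exact oscillations: a vector \<open>d\<close>
  can then be propagated linearly by \<open>dobrushin\<close>.\<close>

definition osc_le :: "((nat \<Rightarrow> real) \<Rightarrow> real) \<Rightarrow> (nat \<Rightarrow> real) \<Rightarrow> bool" where
  "osc_le f d \<longleftrightarrow>
     (\<forall>k\<in>{1..N}. \<forall>\<sigma>\<in>spin_configs N. \<bar>f (\<sigma>(k := 1)) - f (\<sigma>(k := -1))\<bar> \<le> d k)"

text \<open>The effect of one Glauber step on oscillation bounds. With probability 1 / N site
  \<open>k\<close> is itself resampled and its oscillation is erased; resampling site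
  \<open>i\<close> leaks the oscillation at \<open>i\<close> into \<open>k\<close> with influence
  coefficient at most \<open>\<beta> * A k i\<close>.\<close>

definition dobrushin :: "(nat \<Rightarrow> real) \<Rightarrow> nat \<Rightarrow> real" where
  "dobrushin d k = (1 - 1 / real N) * d k + \<beta> / real N * (\<Sum>i=1..N. A k i * d i)"

text \<open>The margin in Dobrushin's condition: one Glauber step shrinks the Euclidean norm of the
  oscillation bounds at least by the factor 1 - gap / N.\<close>

definition gap :: real where "gap = 1 - \<beta> * \<rho>"

lemma A_sym: "i \<in> {1..N} \<Longrightarrow> j \<in> {1..N} \<Longrightarrow> A i j = A j i"
  and A_nonneg: "i \<in> {1..N} \<Longrightarrow> j \<in> {1..N} \<Longrightarrow> 0 \<le> A i j"
  and A_diag: "i \<in> {1..N} \<Longrightarrow> A i i = 0"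
  using coupling by (auto simp: coupling_matrix_def)

lemma rho_nonneg: "0 \<le> \<rho>"
proof -
  have "0 \<le> row_sum N A 1"
    unfolding row_sum_def using N_pos by (intro sum_nonneg A_nonneg) auto
  then show ?thesis using row_sum_le[of 1] N_pos by simp
qed

lemma gap_pos: "0 < gap" and gap_le_1: "gap \<le> 1"
  using subcritical beta_pos rho_nonneg by (auto simp: gap_def)

lemma prob_nonneg: "0 \<le> prob \<sigma>"
  using ising_partition_pos[of N A \<beta> 0] by (simp add: prob_def ising_weight_def)

lemma sum_prob: "(\<Sum>\<sigma>\<in>spin_configs N. prob \<sigma>) = 1"
  using ising_partition_pos[of N A \<beta> 0]
  by (simp add: prob_def ising_partition_def[symmetric] flip: sum_divide_distrib)

lemma expect_const [simp]: "expect (\<lambda>\<sigma>. c) = c"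
  by (simp add: expect_def sum_prob flip: sum_distrib_right)

lemma expect_add: "expect (\<lambda>\<sigma>. f \<sigma> + g \<sigma>) = expect f + expect g"
  by (simp add: expect_def distrib_left sum.distrib)

lemma expect_diff: "expect (\<lambda>\<sigma>. f \<sigma> - g \<sigma>) = expect f - expect g"
  by (simp add: expect_def right_diff_distrib sum_subtractf)

lemma expect_cmult: "expect (\<lambda>\<sigma>. c * f \<sigma>) = c * expect f"
  by (simp add: expect_def sum_distrib_left mult_ac)

lemma expect_divide: "expect (\<lambda>\<sigma>. f \<sigma> / c) = expect f / c"
  using expect_cmult[of "inverse c" f] by (simp add: field_class.field_divide_inverse mult.commute)

lemma expect_sum: "expect (\<lambda>\<sigma>. \<Sum>i\<in>I. f i \<sigma>) = (\<Sum>i\<in>I. expect (f i))"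
  unfolding expect_def sum_distrib_left by (rule sum.swap)

lemma expect_cong: "(\<And>\<sigma>. \<sigma> \<in> spin_configs N \<Longrightarrow> f \<sigma> = g \<sigma>) \<Longrightarrow> expect f = expect g"
  by (simp add: expect_def)

lemma expect_mono: "(\<And>\<sigma>. \<sigma> \<in> spin_configs N \<Longrightarrow> f \<sigma> \<le> g \<sigma>) \<Longrightarrow> expect f \<le> expect g"
  unfolding expect_def by (intro sum_mono mult_left_mono prob_nonneg)

lemma expect_nonneg: "(\<And>\<sigma>. \<sigma> \<in> spin_configs N \<Longrightarrow> 0 \<le> f \<sigma>) \<Longrightarrow> 0 \<le> expect f"
  using expect_mono[of "\<lambda>_. 0" f] by simp

lemma abs_expect_le: "\<bar>expect f\<bar> \<le> expect (\<lambda>\<sigma>. \<bar>f \<sigma>\<bar>)"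
  unfolding expect_def by (rule order_trans[OF sum_abs]) (simp add: abs_mult prob_nonneg)

lemma expect_abs_le_sqrt: "expect (\<lambda>\<sigma>. \<bar>f \<sigma>\<bar>) \<le> sqrt (expect (\<lambda>\<sigma>. (f \<sigma>)\<^sup>2))"
proof (rule real_le_rsqrt)
  define m where "m = expect (\<lambda>\<sigma>. \<bar>f \<sigma>\<bar>)"
  have "0 \<le> expect (\<lambda>\<sigma>. (\<bar>f \<sigma>\<bar> - m)\<^sup>2)" by (rule expect_nonneg) simp
  also have "(\<lambda>\<sigma>. (\<bar>f \<sigma>\<bar> - m)\<^sup>2) = (\<lambda>\<sigma>. (f \<sigma>)\<^sup>2 - 2 * m * \<bar>f \<sigma>\<bar> + m\<^sup>2)"
    by (simp add: power2_diff mult_ac fun_eq_iff)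
  also have "expect \<dots> = expect (\<lambda>\<sigma>. (f \<sigma>)\<^sup>2) - m\<^sup>2"
    by (simp add: expect_add expect_diff expect_cmult flip: m_def) (simp add: power2_eq_square)
  finally show "(expect (\<lambda>\<sigma>. \<bar>f \<sigma>\<bar>))\<^sup>2 \<le> expect (\<lambda>\<sigma>. (f \<sigma>)\<^sup>2)" by (simp add: m_def)
qed

lemma prob_ising_pmf_eq_expect:
  "measure_pmf.prob (ising_pmf N A \<beta> 0) {\<sigma>. P \<sigma>} = expect (\<lambda>\<sigma>. of_bool (P \<sigma>))"
proof -
  have "measure_pmf.prob (ising_pmf N A \<beta> 0) {\<sigma>. P \<sigma>}
    = measure_pmf.expectation (ising_pmf N A \<beta> 0) (\<lambda>\<sigma>. of_bool (P \<sigma>))"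
  proof -
    have "(\<lambda>\<sigma>. of_bool (P \<sigma>)) = indicat_real {\<sigma>. P \<sigma>}"
      by (simp add: indicator_def fun_eq_iff)
    then show ?thesis by simp
  qed
  also have "\<dots> = (\<Sum>\<sigma>\<in>spin_configs N. pmf (ising_pmf N A \<beta> 0) \<sigma> *\<^sub>R of_bool (P \<sigma>))"
    by (rule integral_measure_pmf) (auto simp: set_pmf_iff pmf_ising_pmf split: if_splits)
  also have "\<dots> = expect (\<lambda>\<sigma>. of_bool (P \<sigma>))"
    by (simp add: expect_def prob_def pmf_ising_pmf)
  finally show ?thesis .
qed

lemma cond_mean_update [simp]: "i \<in> {1..N} \<Longrightarrow> cond_mean i (\<sigma>(i := s)) = cond_mean i \<sigma>"
  unfolding cond_mean_def local_field_def
  by (intro arg_cong[of _ _ "\<lambda>x. tanh (\<beta> * x)"] sum.cong) (auto simp: A_diag)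

lemma cond_mean_bounds: "-1 < cond_mean i \<sigma>" "cond_mean i \<sigma> < 1"
  by (simp_all add: cond_mean_def tanh_real_lt_1 tanh_real_gt_neg1)

lemma cond_mean_sq_le_1: "(cond_mean i \<sigma>)\<^sup>2 \<le> 1"
  using cond_mean_bounds[of i \<sigma>] by (simp add: abs_square_le_1)

text \<open>Detailed balance for a flip of spin \<open>i\<close>. As the diagonal vanishes, the
  quadratic form depends on the value \<open>s\<close> of that spin only through 2 * s * m, so the
  two weights have ratio exp (2 * \<beta> * m), which is (1 + t) / (1 - t) for t = tanh (\<beta> *
  m).\<close>

lemma prob_ratio:
  assumes "i \<in> {1..N}"
  shows "prob (\<sigma>(i := 1)) * (1 - cond_mean i \<sigma>) = prob (\<sigma>(i := -1)) * (1 + cond_mean i \<sigma>)"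
proof -
  define \<tau> where "\<tau> = \<sigma>(i := 0)"
  define Q where "Q = (\<Sum>a=1..N. \<Sum>b=1..N. \<tau> a * A a b * \<tau> b)"
  define m where "m = local_field i \<sigma>"
  have m: "(\<Sum>b=1..N. A i b * \<tau> b) = m"
    unfolding m_def local_field_def \<tau>_def by (intro sum.cong) (use assms A_diag in auto)
  have m': "(\<Sum>a=1..N. \<tau> a * A a i) = m"
    unfolding m[symmetric] by (intro sum.cong) (use assms A_sym in auto)
  have "(\<Sum>a=1..N. \<Sum>b=1..N. (\<sigma>(i := s)) a * A a b * (\<sigma>(i := s)) b) = Q + 2 * s * m" for s
  proof -
    \<comment> \<open>The configuration is split into \<tau>, with spin \<open>i\<close> set to 0,
      and a perturbation at \<open>i\<close>; the quadratic form expands into four sums.\<close>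
    have eq: "(\<sigma>(i := s)) = (\<lambda>a. \<tau> a + (if a = i then s else 0))"
      by (auto simp: \<tau>_def)
    have "(\<Sum>a=1..N. \<Sum>b=1..N. (\<sigma>(i := s)) a * A a b * (\<sigma>(i := s)) b)
      = (\<Sum>a=1..N. \<Sum>b=1..N. \<tau> a * A a b * \<tau> b + (if b = i then s * (\<tau> a * A a b) else 0)
          + (if a = i then s * (A a b * \<tau> b) else 0) + (if a = i then if b = i then s * s * A a b else 0 else 0))"
      unfolding eq by (intro sum.cong) (auto simp: algebra_simps)
    also have "\<dots> = Q + s * (\<Sum>a=1..N. \<tau> a * A a i) + s * (\<Sum>b=1..N. A i b * \<tau> b) + s * s * A i i"
    proof -
      have "(\<Sum>a=1..N. \<Sum>b=1..N. if a = i then s * (A a b * \<tau> b) else 0)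
        = (\<Sum>b=1..N. \<Sum>a=1..N. if a = i then s * (A a b * \<tau> b) else 0)"
        by (rule sum.swap)
      moreover have "(\<Sum>a=1..N. \<Sum>b=1..N. if a = i then if b = i then s * s * A a b else 0 else 0)
        = (\<Sum>a=1..N. if a = i then s * s * A a i else 0)"
        using assms by (intro sum.cong) (auto simp: sum.delta)
      ultimately show ?thesis
        using assms by (simp add: sum.distrib Q_def sum_distrib_left)
    qed
    finally show ?thesis unfolding m m' using assms by (simp add: A_diag)
  qed
  then have "prob (\<sigma>(i := s)) = exp (\<beta> / 2 * Q) / ising_partition N A \<beta> 0 * exp (s * (\<beta> * m))" for s
    unfolding prob_def ising_weight_def by (simp add: algebra_simps flip: exp_add)
  moreover have "exp (\<beta> * m) * (1 - tanh (\<beta> * m)) = exp (- (\<beta> * m)) * (1 + tanh (\<beta> * m))"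
  proof -
    have "exp (\<beta> * m) + exp (- (\<beta> * m)) \<noteq> 0"
      using exp_gt_zero[of "\<beta> * m"] exp_gt_zero[of "- (\<beta> * m)"] by linarith
    then show ?thesis unfolding tanh_altdef by (simp add: field_simps)
  qed
  ultimately show ?thesis
    by (simp add: cond_mean_def m_def)
qed

text \<open>On each pair differing at \<open>i\<close>, detailed balance splits the total weight
  \<open>w\<close> in the proportions (1 + t) / 2 and (1 - t) / 2, and the resampled observable is
  constant on the pair and equal to that weighted average.\<close>

lemma expect_resample:
  assumes i: "i \<in> {1..N}"
  shows "expect (resample i f) = expect f"
proof -
  have "prob (\<sigma>(i := 1)) * resample i f (\<sigma>(i := 1)) + prob (\<sigma>(i := -1)) * resample i f (\<sigma>(i := -1))
    = prob (\<sigma>(i := 1)) * f (\<sigma>(i := 1)) + prob (\<sigma>(i := -1)) * f (\<sigma>(i := -1))" for \<sigma>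
  proof -
    define t where "t = cond_mean i \<sigma>"
    define w where "w = prob (\<sigma>(i := 1)) + prob (\<sigma>(i := -1))"
    have w: "prob (\<sigma>(i := 1)) = w * ((1 + t) / 2)" "prob (\<sigma>(i := -1)) = w * ((1 - t) / 2)"
      using prob_ratio[OF i, of \<sigma>] by (simp_all add: w_def t_def field_simps)
    have "resample i f (\<sigma>(i := s)) = (1 + t) / 2 * f (\<sigma>(i := 1)) + (1 - t) / 2 * f (\<sigma>(i := -1))" for s
      using i by (simp add: resample_def t_def)
    then show ?thesis
      unfolding w by (simp only:) (simp add: field_simps)
  qed
  then show ?thesis
    unfolding expect_def by (subst (1 2) sum_spin_configs_pair[OF i]) simp
qed

lemma resample_update [simp]:
  "i \<in> {1..N} \<Longrightarrow> resample i f (\<sigma>(i := s)) = resample i f \<sigma>"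
  by (simp add: resample_def)

text \<open>A factor that does not depend on spin \<open>i\<close> can be pulled out of the
  conditional expectation.\<close>

lemma expect_resample_mult:
  assumes i: "i \<in> {1..N}"
  shows "expect (\<lambda>\<sigma>. resample i f \<sigma> * g \<sigma>) = expect (\<lambda>\<sigma>. resample i f \<sigma> * resample i g \<sigma>)"
proof -
  have "resample i (\<lambda>\<sigma>. resample i f \<sigma> * g \<sigma>) = (\<lambda>\<sigma>. resample i f \<sigma> * resample i g \<sigma>)"
    unfolding resample_def[of _ "\<lambda>\<sigma>. resample i f \<sigma> * g \<sigma>"] resample_def[of _ g]
    using i by (simp add: fun_eq_iff distrib_left mult_ac)
  then show ?thesis
    using expect_resample[OF i, of "\<lambda>\<sigma>. resample i f \<sigma> * g \<sigma>"] by simp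
qed

text \<open>A discrete integration by parts: with t the conditional mean, resampling produces the
  weights (1 + t) / 2 * (1 - t) and (1 - t) / 2 * (- 1 - t), which are equal up to sign.\<close>

lemma expect_spin_minus_cond_mean:
  assumes i: "i \<in> {1..N}"
  shows "expect (\<lambda>\<sigma>. (\<sigma> i - cond_mean i \<sigma>) * g \<sigma>)
    = expect (\<lambda>\<sigma>. (1 - (cond_mean i \<sigma>)\<^sup>2) / 2 * (g (\<sigma>(i := 1)) - g (\<sigma>(i := -1))))"
proof -
  have "resample i (\<lambda>\<sigma>. (\<sigma> i - cond_mean i \<sigma>) * g \<sigma>) =
     (\<lambda>\<sigma>. (1 - (cond_mean i \<sigma>)\<^sup>2) / 2 * (g (\<sigma>(i := 1)) - g (\<sigma>(i := -1))))"
    using i by (auto simp: fun_eq_iff resample_def power2_eq_square field_simps)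
  then show ?thesis
    using expect_resample[OF i, of "\<lambda>\<sigma>. (\<sigma> i - cond_mean i \<sigma>) * g \<sigma>"] by simp
qed

section \<open>Oscillations of observables and their contraction by the Glauber dynamics\<close>

lemma osc_leD:
  assumes "osc_le f d" "k \<in> {1..N}" "\<sigma> \<in> spin_configs N"
  shows "\<bar>f (\<sigma>(k := 1)) - f (\<sigma>(k := -1))\<bar> \<le> d k"
  using assms by (auto simp: osc_le_def)

lemma osc_le_nonneg: "osc_le f d \<Longrightarrow> k \<in> {1..N} \<Longrightarrow> 0 \<le> d k"
proof -
  assume *: "osc_le f d" "k \<in> {1..N}"
  obtain \<sigma> where "\<sigma> \<in> spin_configs N"
    using sum_prob by (metis all_not_in_conv sum.empty zero_neq_one)
  then show ?thesis using osc_leD[OF *] abs_ge_zero order_trans by blast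
qed

lemma abs_diff_update_le:
  assumes "osc_le f d" "k \<in> {1..N}" "\<sigma> \<in> spin_configs N" "s = 1 \<or> s = -1"
  shows "\<bar>f (\<sigma>(k := s)) - f \<sigma>\<bar> \<le> d k"
  using spin_configs_cases[OF assms(3,2)] osc_leD[OF assms(1-3)] osc_le_nonneg[OF assms(1,2)] assms(4)
  by (smt (verit))

lemma abs_diff_le_sum_osc:
  assumes f: "osc_le f d" and \<sigma>: "\<sigma> \<in> spin_configs N" and \<sigma>': "\<sigma>' \<in> spin_configs N"
  shows "\<bar>f \<sigma>' - f \<sigma>\<bar> \<le> (\<Sum>k=1..N. d k)"
proof -
  \<comment> \<open>Interpolation from \<sigma> to \<sigma>': the first \<open>n\<close> spins have
    been exchanged, so consecutive configurations differ at one site at most.\<close>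
  define \<tau> where "\<tau> n = (\<lambda>j. if j \<in> {1..n} then \<sigma>' j else \<sigma> j)" for n
  have "n \<le> N \<Longrightarrow> \<tau> n \<in> spin_configs N \<and> \<bar>f (\<tau> n) - f \<sigma>\<bar> \<le> (\<Sum>k=1..n. d k)" for n
  proof (induction n)
    case 0
    then show ?case using \<sigma> by (simp add: \<tau>_def)
  next
    case (Suc n)
    have eq: "\<tau> (Suc n) = (\<tau> n)(Suc n := \<sigma>' (Suc n))"
      by (auto simp: \<tau>_def fun_eq_iff)
    have n: "Suc n \<in> {1..N}" using Suc by simp
    have s: "\<sigma>' (Suc n) = 1 \<or> \<sigma>' (Suc n) = -1"
      using spin_configs_cases[OF \<sigma>' n] by blast
    have \<tau>: "\<tau> n \<in> spin_configs N" using Suc by simp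
    have "\<bar>f (\<tau> (Suc n)) - f (\<tau> n)\<bar> \<le> d (Suc n)"
      unfolding eq by (rule abs_diff_update_le[OF f n \<tau> s])
    moreover have "\<bar>f (\<tau> n) - f \<sigma>\<bar> \<le> (\<Sum>k=1..n. d k)" using Suc by simp
    ultimately show ?case
      using spin_configs_update[OF \<tau> n s] unfolding eq by (simp del: fun_upd_apply)
  qed
  moreover have "\<tau> N = \<sigma>'"
    using \<sigma> \<sigma>' by (auto simp: \<tau>_def spin_configs_def fun_eq_iff PiE_def extensional_def)
  ultimately show ?thesis by fastforce
qed

text \<open>A centred observable is the average of its differences
  \<open>f \<sigma> - f \<sigma>'\<close> over an independent copy \<sigma>'.\<close>

lemma abs_le_sum_osc:
  assumes f: "osc_le f d" and "expect f = 0" and \<sigma>: "\<sigma> \<in> spin_configs N"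
  shows "\<bar>f \<sigma>\<bar> \<le> (\<Sum>k=1..N. d k)"
proof -
  have "f \<sigma> = expect (\<lambda>\<sigma>'. f \<sigma> - f \<sigma>')" using assms by (simp add: expect_diff)
  also have "\<bar>\<dots>\<bar> \<le> expect (\<lambda>\<sigma>'. \<bar>f \<sigma> - f \<sigma>'\<bar>)" by (rule abs_expect_le)
  also have "\<dots> \<le> expect (\<lambda>_. \<Sum>k=1..N. d k)"
    by (intro expect_mono abs_diff_le_sum_osc[OF f] \<sigma>)
  finally show ?thesis by simp
qed

lemma abs_diff_resample_le:
  assumes f: "osc_le f d" and i: "i \<in> {1..N}" and \<sigma>: "\<sigma> \<in> spin_configs N"
  shows "\<bar>f \<sigma> - resample i f \<sigma>\<bar> \<le> d i"
proof -
  define t where "t = cond_mean i \<sigma>"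
  have t: "0 \<le> (1 + t) / 2" "0 \<le> (1 - t) / 2"
    using cond_mean_bounds[of i \<sigma>] by (auto simp: t_def)
  have eq: "f \<sigma> - resample i f \<sigma>
    = (1 + t) / 2 * (f \<sigma> - f (\<sigma>(i := 1))) + (1 - t) / 2 * (f \<sigma> - f (\<sigma>(i := -1)))"
    by (simp add: resample_def t_def field_simps)
  have "\<bar>f \<sigma> - resample i f \<sigma>\<bar> \<le> (1 + t) / 2 * \<bar>f \<sigma> - f (\<sigma>(i := 1))\<bar> + (1 - t) / 2 * \<bar>f \<sigma> - f (\<sigma>(i := -1))\<bar>"
    unfolding eq by (rule order_trans[OF abs_triangle_ineq]) (use t in \<open>simp add: abs_mult\<close>)
  also have "\<dots> \<le> (1 + t) / 2 * d i + (1 - t) / 2 * d i"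
    using abs_diff_update_le[OF f i \<sigma>] t
    by (intro add_mono mult_left_mono) (auto simp: abs_minus_commute)
  finally show ?thesis by (simp add: field_simps)
qed

text \<open>Flipping spin \<open>k\<close> acts in two ways: directly on \<open>f\<close>, at cost
  \<open>d k\<close>, and on the conditional law of spin \<open>i\<close>. The local field at
  \<open>i\<close> moves by 2 * A i k and tanh is 1-Lipschitz, so the conditional probability moves
  by at most \<open>\<beta> * A k i\<close>, and this multiplies the oscillation at
  \<open>i\<close>.\<close>

lemma osc_resample_le:
  assumes f: "osc_le f d" and i: "i \<in> {1..N}" and k: "k \<in> {1..N}" and "i \<noteq> k"
    and \<sigma>: "\<sigma> \<in> spin_configs N"
  shows "\<bar>resample i f (\<sigma>(k := 1)) - resample i f (\<sigma>(k := -1))\<bar> \<le> d k + \<beta> * A k i * d i"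
proof -
  define t where "t s = cond_mean i (\<sigma>(k := s))" for s
  define h where "h r s = f (\<sigma>(i := s, k := r))" for r s
  have res: "resample i f (\<sigma>(k := r)) = (1 + t r) / 2 * h r 1 + (1 - t r) / 2 * h r (-1)" for r
    using \<open>i \<noteq> k\<close> by (simp add: resample_def t_def h_def fun_upd_twist)
  have t: "0 \<le> (1 + t 1) / 2" "0 \<le> (1 - t 1) / 2"
    using cond_mean_bounds[of i "\<sigma>(k := 1)"] by (auto simp: t_def)
  have hk: "\<bar>h 1 s - h (-1) s\<bar> \<le> d k" if "s = 1 \<or> s = -1" for s
    unfolding h_def by (rule osc_leD[OF f k spin_configs_update[OF \<sigma> i that]])
  have hi: "\<bar>h (-1) 1 - h (-1) (-1)\<bar> \<le> d i"
    using osc_leD[OF f i spin_configs_update[OF \<sigma> k, of "-1"]] \<open>i \<noteq> k\<close>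
    by (simp add: h_def fun_upd_twist)
  have "local_field i (\<sigma>(k := 1)) - local_field i (\<sigma>(k := -1))
    = (\<Sum>j=1..N. if j = k then 2 * A i k else 0)"
    unfolding local_field_def sum_subtractf[symmetric] by (intro sum.cong) auto
  also have "\<dots> = 2 * A i k" using k by simp
  finally have "\<bar>t 1 - t (-1)\<bar> \<le> \<bar>\<beta> * (2 * A i k)\<bar>"
    using tanh_real_lipschitz[of "\<beta> * local_field i (\<sigma>(k := 1))" "\<beta> * local_field i (\<sigma>(k := -1))"]
    by (simp add: t_def cond_mean_def flip: right_diff_distrib)
  then have tdiff: "\<bar>(t 1 - t (-1)) / 2\<bar> \<le> \<beta> * A k i"
    using beta_pos A_nonneg[OF i k] A_sym[OF i k] by simp
  have eq: "resample i f (\<sigma>(k := 1)) - resample i f (\<sigma>(k := -1))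
    = (1 + t 1) / 2 * (h 1 1 - h (-1) 1) + (1 - t 1) / 2 * (h 1 (-1) - h (-1) (-1))
      + (t 1 - t (-1)) / 2 * (h (-1) 1 - h (-1) (-1))"
    unfolding res by (simp add: field_simps)
  have "\<bar>resample i f (\<sigma>(k := 1)) - resample i f (\<sigma>(k := -1))\<bar> \<le> (1 + t 1) / 2 * \<bar>h 1 1 - h (-1) 1\<bar> + (1 - t 1) / 2 * \<bar>h 1 (-1) - h (-1) (-1)\<bar>
      + \<bar>(t 1 - t (-1)) / 2\<bar> * \<bar>h (-1) 1 - h (-1) (-1)\<bar>"
    unfolding eq
    by (rule order_trans[OF abs_triangle_ineq], rule add_mono, rule order_trans[OF abs_triangle_ineq])
      (use t in \<open>simp_all add: abs_mult\<close>)
  also have "\<dots> \<le> (1 + t 1) / 2 * d k + (1 - t 1) / 2 * d k + \<beta> * A k i * d i"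
    using t hk hi tdiff by (intro add_mono mult_left_mono mult_mono) auto
  finally show ?thesis by (simp add: field_simps)
qed

lemma osc_glauber:
  assumes f: "osc_le f d"
  shows "osc_le (glauber f) (dobrushin d)"
  unfolding osc_le_def
proof (intro ballI)
  fix k \<sigma> assume k: "k \<in> {1..N}" and \<sigma>: "\<sigma> \<in> spin_configs N"
  \<comment> \<open>Resampling site \<open>k\<close> forgets spin \<open>k\<close>, so the term with
    i = k is 0; the subtracted \<open>d k\<close> records this and produces the factor 1 - 1 /
    N.\<close>
  have step: "\<bar>resample i f (\<sigma>(k := 1)) - resample i f (\<sigma>(k := -1))\<bar>
      \<le> d k + \<beta> * A k i * d i - (if i = k then d k else 0)" if i: "i \<in> {1..N}" for i
    using osc_resample_le[OF f i k _ \<sigma>] i by (cases "i = k") (auto simp: A_diag)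
  have "\<bar>glauber f (\<sigma>(k := 1)) - glauber f (\<sigma>(k := -1))\<bar>
    = \<bar>\<Sum>i=1..N. resample i f (\<sigma>(k := 1)) - resample i f (\<sigma>(k := -1))\<bar> / real N"
    by (simp add: glauber_def sum_subtractf flip: diff_divide_distrib)
  also have "\<dots> \<le> (\<Sum>i=1..N. d k + \<beta> * A k i * d i - (if i = k then d k else 0)) / real N"
    by (intro divide_right_mono order_trans[OF sum_abs] sum_mono step) auto
  also have "\<dots> = (real N * d k + \<beta> * (\<Sum>i=1..N. A k i * d i) - d k) / real N"
    using k by (simp add: sum.distrib sum_subtractf sum_distrib_left mult_ac)
  also have "\<dots> = dobrushin d k"
    using N_pos by (simp add: dobrushin_def field_simps)
  finally show "\<bar>glauber f (\<sigma>(k := 1)) - glauber f (\<sigma>(k := -1))\<bar> \<le> dobrushin d k" .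
qed

text \<open>Schur test: Cauchy-Schwarz with each entry split into two square roots, together with
  symmetry, shows that a non-negative matrix with row sums at most \<rho> has operator norm at most
  \<rho>. The triangle inequality then gives the factor 1 - 1 / N + \<beta> * \<rho> / N.\<close>

lemma L2_set_dobrushin:
  assumes d: "\<And>k. k \<in> {1..N} \<Longrightarrow> 0 \<le> d k"
  shows "L2_set (dobrushin d) {1..N} \<le> (1 - gap / real N) * L2_set d {1..N}"
proof -
  define D where "D = (\<Sum>j=1..N. (d j)\<^sup>2)"
  have row: "(\<Sum>j=1..N. A i j) \<le> \<rho>" if "i \<in> {1..N}" for i
    using row_sum_le[OF that] by (simp add: row_sum_def)
  have "(\<Sum>i=1..N. (\<Sum>j=1..N. A i j * d j)\<^sup>2) \<le> (\<Sum>i=1..N. \<rho> * (\<Sum>j=1..N. A i j * (d j)\<^sup>2))"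
  proof (rule sum_mono)
    fix i assume i: "i \<in> {1..N}"
    have "(\<Sum>j=1..N. A i j * d j)\<^sup>2 = (\<Sum>j=1..N. sqrt (A i j) * (sqrt (A i j) * d j))\<^sup>2"
      using A_nonneg[OF i] by (intro arg_cong[of _ _ "\<lambda>x. x\<^sup>2"] sum.cong) (auto simp flip: mult.assoc)
    also have "\<dots> \<le> (\<Sum>j=1..N. (sqrt (A i j))\<^sup>2) * (\<Sum>j=1..N. (sqrt (A i j) * d j)\<^sup>2)"
      by (rule Cauchy_Schwarz_ineq_sum)
    also have "\<dots> = (\<Sum>j=1..N. A i j) * (\<Sum>j=1..N. A i j * (d j)\<^sup>2)"
      using A_nonneg[OF i] by (simp add: power_mult_distrib)
    also have "\<dots> \<le> \<rho> * (\<Sum>j=1..N. A i j * (d j)\<^sup>2)"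
      using A_nonneg[OF i] by (intro mult_right_mono row i sum_nonneg) auto
    finally show "(\<Sum>j=1..N. A i j * d j)\<^sup>2 \<le> \<rho> * (\<Sum>j=1..N. A i j * (d j)\<^sup>2)" .
  qed
  also have "\<dots> = \<rho> * (\<Sum>j=1..N. \<Sum>i=1..N. A j i * (d j)\<^sup>2)"
    unfolding sum_distrib_left[symmetric]
    by (subst sum.swap, intro arg_cong[of _ _ "(*) \<rho>"] sum.cong refl) (metis A_sym)
  also have "\<dots> \<le> \<rho> * (\<Sum>j=1..N. \<rho> * (d j)\<^sup>2)"
    unfolding sum_distrib_right[symmetric]
    by (intro mult_left_mono sum_mono mult_right_mono row rho_nonneg) auto
  also have "\<dots> = \<rho>\<^sup>2 * D"
    by (simp add: D_def power2_eq_square mult.assoc flip: sum_distrib_left)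
  finally have "L2_set (\<lambda>i. \<Sum>j=1..N. A i j * d j) {1..N} \<le> sqrt (\<rho>\<^sup>2 * D)"
    by (simp add: L2_set_def)
  then have op: "L2_set (\<lambda>i. \<Sum>j=1..N. A i j * d j) {1..N} \<le> \<rho> * L2_set d {1..N}"
    using rho_nonneg by (simp add: L2_set_def D_def real_sqrt_mult)
  have "L2_set (dobrushin d) {1..N} \<le> L2_set (\<lambda>k. (1 - 1 / real N) * d k) {1..N}
      + L2_set (\<lambda>k. \<beta> / real N * (\<Sum>i=1..N. A k i * d i)) {1..N}"
    unfolding dobrushin_def by (rule L2_set_triangle_ineq)
  also have "\<dots> = (1 - 1 / real N) * L2_set d {1..N}
      + \<beta> / real N * L2_set (\<lambda>i. \<Sum>j=1..N. A i j * d j) {1..N}"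
    using N_pos beta_pos by (simp add: L2_set_right_distrib del: times_divide_eq_left)
  also have "\<dots> \<le> (1 - 1 / real N) * L2_set d {1..N} + \<beta> / real N * (\<rho> * L2_set d {1..N})"
    using beta_pos by (intro add_left_mono mult_left_mono op) auto
  also have "\<dots> = (1 - gap / real N) * L2_set d {1..N}"
    using N_pos by (simp add: gap_def field_simps)
  finally show ?thesis .
qed

section \<open>Covariances and moments by iterating the Glauber dynamics\<close>

lemma expect_glauber: "expect (glauber f) = expect f"
  unfolding glauber_def expect_divide expect_sum using N_pos expect_resample by simp

lemma osc_glauber_power:
  assumes "osc_le f d"
  shows "osc_le ((glauber ^^ n) f) ((dobrushin ^^ n) d)"
  by (induction n) (use assms osc_glauber in auto)

lemma L2_set_dobrushin_power:
  assumes "osc_le f d"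
  shows "L2_set ((dobrushin ^^ n) d) {1..N} \<le> (1 - gap / real N) ^ n * L2_set d {1..N}"
proof (induction n)
  case (Suc n)
  have "L2_set ((dobrushin ^^ Suc n) d) {1..N} \<le> (1 - gap / real N) * L2_set ((dobrushin ^^ n) d) {1..N}"
    using L2_set_dobrushin[of "(dobrushin ^^ n) d"] osc_le_nonneg[OF osc_glauber_power[OF assms]] by simp
  also have "\<dots> \<le> (1 - gap / real N) * ((1 - gap / real N) ^ n * L2_set d {1..N})"
    using Suc gap_le_1 N_pos by (intro mult_left_mono) (auto simp: field_simps)
  finally show ?case by simp
qed simp

text \<open>\<open>f - glauber f\<close> is the average over \<open>i\<close> of
  \<open>f - resample i f\<close>, and each of these is orthogonal to observables that do not depend
  on spin \<open>i\<close>. Hence \<open>g\<close> may be replaced by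
  \<open>g - resample i g\<close>, and Cauchy-Schwarz over the sites concludes.\<close>

lemma expect_diff_glauber_mult_le:
  assumes f: "osc_le f d"
    and g: "\<And>i. i \<in> {1..N} \<Longrightarrow> expect (\<lambda>\<sigma>. \<bar>g \<sigma> - resample i g \<sigma>\<bar>) \<le> e i"
  shows "\<bar>expect (\<lambda>\<sigma>. (f \<sigma> - glauber f \<sigma>) * g \<sigma>)\<bar> \<le> L2_set d {1..N} * L2_set e {1..N} / real N"
proof -
  have e: "0 \<le> e i" if "i \<in> {1..N}" for i
    by (rule order_trans[OF expect_nonneg g[OF that]]) auto
  have "expect (\<lambda>\<sigma>. (f \<sigma> - glauber f \<sigma>) * g \<sigma>)
    = expect (\<lambda>\<sigma>. (\<Sum>i=1..N. (f \<sigma> - resample i f \<sigma>) * g \<sigma>) / real N)"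
    using N_pos by (intro expect_cong)
      (simp add: glauber_def sum_subtractf field_simps flip: sum_distrib_right sum_distrib_left)
  also have "\<dots> = (\<Sum>i=1..N. expect (\<lambda>\<sigma>. (f \<sigma> - resample i f \<sigma>) * g \<sigma>)) / real N"
    by (simp add: expect_divide expect_sum)
  also have "(\<Sum>i=1..N. expect (\<lambda>\<sigma>. (f \<sigma> - resample i f \<sigma>) * g \<sigma>))
    = (\<Sum>i=1..N. expect (\<lambda>\<sigma>. (f \<sigma> - resample i f \<sigma>) * (g \<sigma> - resample i g \<sigma>)))"
  proof (intro sum.cong refl)
    fix i assume i: "i \<in> {1..N}"
    have "expect (\<lambda>\<sigma>. (f \<sigma> - resample i f \<sigma>) * resample i g \<sigma>)
      = expect (\<lambda>\<sigma>. resample i g \<sigma> * f \<sigma>) - expect (\<lambda>\<sigma>. resample i g \<sigma> * resample i f \<sigma>)"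
      by (simp add: algebra_simps flip: expect_diff)
    then have "expect (\<lambda>\<sigma>. (f \<sigma> - resample i f \<sigma>) * resample i g \<sigma>) = 0"
      using expect_resample_mult[OF i, of g f] by simp
    then show "expect (\<lambda>\<sigma>. (f \<sigma> - resample i f \<sigma>) * g \<sigma>)
      = expect (\<lambda>\<sigma>. (f \<sigma> - resample i f \<sigma>) * (g \<sigma> - resample i g \<sigma>))"
      by (simp add: right_diff_distrib expect_diff)
  qed
  finally have eq: "expect (\<lambda>\<sigma>. (f \<sigma> - glauber f \<sigma>) * g \<sigma>)
    = (\<Sum>i=1..N. expect (\<lambda>\<sigma>. (f \<sigma> - resample i f \<sigma>) * (g \<sigma> - resample i g \<sigma>))) / real N" .
  have "\<bar>expect (\<lambda>\<sigma>. (f \<sigma> - glauber f \<sigma>) * g \<sigma>)\<bar>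
    \<le> (\<Sum>i=1..N. \<bar>expect (\<lambda>\<sigma>. (f \<sigma> - resample i f \<sigma>) * (g \<sigma> - resample i g \<sigma>))\<bar>) / real N"
    unfolding eq by (simp add: divide_right_mono sum_abs)
  also have "\<dots> \<le> (\<Sum>i=1..N. \<bar>d i\<bar> * \<bar>e i\<bar>) / real N"
  proof (intro divide_right_mono sum_mono)
    fix i assume i: "i \<in> {1..N}"
    have "\<bar>expect (\<lambda>\<sigma>. (f \<sigma> - resample i f \<sigma>) * (g \<sigma> - resample i g \<sigma>))\<bar>
      \<le> expect (\<lambda>\<sigma>. d i * \<bar>g \<sigma> - resample i g \<sigma>\<bar>)"
      using abs_diff_resample_le[OF f i]
      by (intro order_trans[OF abs_expect_le] expect_mono) (simp add: abs_mult mult_right_mono)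
    also have "\<dots> \<le> d i * e i"
      unfolding expect_cmult using g[OF i] osc_le_nonneg[OF f i] by (rule mult_left_mono)
    finally show "\<bar>expect (\<lambda>\<sigma>. (f \<sigma> - resample i f \<sigma>) * (g \<sigma> - resample i g \<sigma>))\<bar> \<le> \<bar>d i\<bar> * \<bar>e i\<bar>"
      using osc_le_nonneg[OF f i] e[OF i] by simp
  qed simp
  also have "\<dots> \<le> L2_set d {1..N} * L2_set e {1..N} / real N"
    by (intro divide_right_mono L2_set_mult_ineq) simp
  finally show ?thesis .
qed

text \<open>The Glauber dynamics contracts oscillations, so \<open>f = \<Sum>\<^sub>n (P\<^sup>n f - P\<^sup>n\<^sup>+\<^sup>1 f)\<close>
  when \<open>f\<close> is centred.\<close>

lemma covariance_le:
  assumes f: "osc_le f d" and "expect f = 0"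
    and g: "\<And>i. i \<in> {1..N} \<Longrightarrow> expect (\<lambda>\<sigma>. \<bar>g \<sigma> - resample i g \<sigma>\<bar>) \<le> e i"
  shows "\<bar>expect (\<lambda>\<sigma>. f \<sigma> * g \<sigma>)\<bar> \<le> L2_set d {1..N} * L2_set e {1..N} / gap"
proof -
  define r where "r = 1 - gap / real N"
  have "gap / real N \<le> 1" "0 < gap / real N"
    using gap_le_1 gap_pos N_pos by auto
  then have r: "0 \<le> r" "r < 1" by (auto simp: r_def)
  define F where "F n = (glauber ^^ n) f" for n
  define B where "B = L2_set d {1..N} * L2_set e {1..N} / real N"
  define K where "K = sqrt (real N) * L2_set d {1..N} * expect (\<lambda>\<sigma>. \<bar>g \<sigma>\<bar>)"
  have F: "osc_le (F n) ((dobrushin ^^ n) d)" for n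
    unfolding F_def by (rule osc_glauber_power[OF f])
  have ExF: "expect (F n) = 0" for n
    unfolding F_def by (induction n) (simp_all add: expect_glauber assms)
  have norm: "L2_set ((dobrushin ^^ n) d) {1..N} \<le> r ^ n * L2_set d {1..N}" for n
    unfolding r_def by (rule L2_set_dobrushin_power[OF f])
  have tele: "\<bar>expect (\<lambda>\<sigma>. f \<sigma> * g \<sigma>)\<bar> \<le> \<bar>expect (\<lambda>\<sigma>. F m \<sigma> * g \<sigma>)\<bar> + (\<Sum>n<m. r ^ n * B)" for m
  proof (induction m)
    case 0
    then show ?case by (simp add: F_def)
  next
    case (Suc m)
    have "expect (\<lambda>\<sigma>. F m \<sigma> * g \<sigma>) = expect (\<lambda>\<sigma>. (F m \<sigma> - glauber (F m) \<sigma>) * g \<sigma>) + expect (\<lambda>\<sigma>. F (Suc m) \<sigma> * g \<sigma>)"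
      by (simp add: F_def algebra_simps flip: expect_add)
    moreover have "\<bar>expect (\<lambda>\<sigma>. (F m \<sigma> - glauber (F m) \<sigma>) * g \<sigma>)\<bar> \<le> r ^ m * B"
    proof (rule order_trans[OF expect_diff_glauber_mult_le[OF F g]])
      show "L2_set ((dobrushin ^^ m) d) {1..N} * L2_set e {1..N} / real N \<le> r ^ m * B"
        using mult_right_mono[OF norm[of m], of "L2_set e {1..N}"]
        by (simp add: B_def divide_right_mono mult.assoc)
    qed
    ultimately show ?case using Suc by simp
  qed
  \<comment> \<open>A crude uniform bound on the iterate suffices: the factor sqrt N does not depend
    on \<open>m\<close> and is beaten by \<open>r ^ m\<close>.\<close>
  have tail: "\<bar>expect (\<lambda>\<sigma>. F m \<sigma> * g \<sigma>)\<bar> \<le> r ^ m * K" for m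
  proof -
    have sum: "(\<Sum>k=1..N. (dobrushin ^^ m) d k) \<le> sqrt (real N) * (r ^ m * L2_set d {1..N})"
    proof -
      have "(\<Sum>k=1..N. (dobrushin ^^ m) d k) \<le> (\<Sum>k=1..N. \<bar>1\<bar> * \<bar>(dobrushin ^^ m) d k\<bar>)"
        by (intro sum_mono) auto
      also have "\<dots> \<le> L2_set (\<lambda>_. 1) {1..N} * L2_set ((dobrushin ^^ m) d) {1..N}"
        by (rule L2_set_mult_ineq)
      also have "\<dots> \<le> sqrt (real N) * (r ^ m * L2_set d {1..N})"
        using norm[of m] by (simp add: L2_set_def[of "\<lambda>_. 1"] mult_left_mono)
      finally show ?thesis .
    qed
    have "\<bar>expect (\<lambda>\<sigma>. F m \<sigma> * g \<sigma>)\<bar> \<le> expect (\<lambda>\<sigma>. sqrt (real N) * (r ^ m * L2_set d {1..N}) * \<bar>g \<sigma>\<bar>)"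
      by (intro order_trans[OF abs_expect_le] expect_mono)
        (simp only: abs_mult mult_right_mono[OF order_trans[OF abs_le_sum_osc[OF F ExF] sum]] abs_ge_zero)
    then show ?thesis unfolding expect_cmult K_def by (simp only: mult_ac)
  qed
  have geom: "(\<Sum>n<m. r ^ n * B) \<le> B / (1 - r)" for m
  proof -
    have B: "0 \<le> B" by (simp add: B_def L2_set_nonneg)
    have "(\<Sum>n<m. r ^ n * B) = (1 - r ^ m) * (B / (1 - r))"
      using r by (simp add: sum_gp_strict flip: sum_distrib_right)
    also have "\<dots> \<le> 1 * (B / (1 - r))"
      using r B by (intro mult_right_mono) auto
    finally show ?thesis by simp
  qed
  have "(\<lambda>m. r ^ m * K + B / (1 - r)) \<longlonglongrightarrow> 0 * K + B / (1 - r)"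
    by (intro tendsto_intros LIMSEQ_power_zero) (use r in auto)
  then have "\<bar>expect (\<lambda>\<sigma>. f \<sigma> * g \<sigma>)\<bar> \<le> 0 * K + B / (1 - r)"
    by (rule LIMSEQ_le_const) (use tele tail geom in \<open>meson add_mono order_trans\<close>)
  \<comment> \<open>Here 1 - r = gap / N, which cancels the factor 1 / N in
    \<open>B\<close>.\<close>
  also have "0 * K + B / (1 - r) = L2_set d {1..N} * L2_set e {1..N} / gap"
    using N_pos gap_pos by (simp add: B_def r_def)
  finally show ?thesis .
qed

lemma second_moment_le:
  assumes f: "osc_le f d" and "expect f = 0"
  shows "expect (\<lambda>\<sigma>. (f \<sigma>)\<^sup>2) \<le> (\<Sum>k=1..N. (d k)\<^sup>2) / gap"
proof -
  have "expect (\<lambda>\<sigma>. \<bar>f \<sigma> - resample i f \<sigma>\<bar>) \<le> d i" if "i \<in> {1..N}" for i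
    using expect_mono[of "\<lambda>\<sigma>. \<bar>f \<sigma> - resample i f \<sigma>\<bar>" "\<lambda>_. d i"] abs_diff_resample_le[OF f that] by simp
  then have "\<bar>expect (\<lambda>\<sigma>. f \<sigma> * f \<sigma>)\<bar> \<le> L2_set d {1..N} * L2_set d {1..N} / gap"
    by (rule covariance_le[OF assms])
  then show ?thesis
    by (simp add: power2_eq_square L2_set_def sum_nonneg flip: real_sqrt_mult)
qed

text \<open>The covariance bound with g = f^3. The conditional fluctuation of the cube is at most
  3/2 * d i times f^2 plus its resampled version, and both of these have mean \<open>V\<close>. So
  the fourth moment is at most 3 * V * D / gap, and \<open>V\<close> is at most D / gap.\<close>

lemma fourth_moment_le:
  assumes f: "osc_le f d" and "expect f = 0"
  shows "expect (\<lambda>\<sigma>. (f \<sigma>) ^ 4) \<le> 3 * ((\<Sum>k=1..N. (d k)\<^sup>2) / gap)\<^sup>2"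
proof -
  define V where "V = expect (\<lambda>\<sigma>. (f \<sigma>)\<^sup>2)"
  define D where "D = (\<Sum>k=1..N. (d k)\<^sup>2)"
  have D: "0 \<le> D" by (simp add: D_def sum_nonneg)
  have cube: "\<bar>a ^ 3 - b ^ 3\<bar> \<le> \<bar>a - b\<bar> * (3 / 2 * (a\<^sup>2 + b\<^sup>2))" for a b :: real
  proof -
    have "a ^ 3 - b ^ 3 = (a - b) * (a\<^sup>2 + a * b + b\<^sup>2)" by algebra
    moreover have "\<bar>a\<^sup>2 + a * b + b\<^sup>2\<bar> \<le> 3 / 2 * (a\<^sup>2 + b\<^sup>2)"
    proof -
      have "0 \<le> (a + b)\<^sup>2" "0 \<le> (a - b)\<^sup>2" "0 \<le> a\<^sup>2" "0 \<le> b\<^sup>2" by auto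
      then show ?thesis by (simp only: power2_sum power2_diff abs_le_iff) argo
    qed
    ultimately show ?thesis by (simp only: abs_mult mult_left_mono abs_ge_zero)
  qed
  have "expect (\<lambda>\<sigma>. \<bar>(f \<sigma>) ^ 3 - resample i (\<lambda>\<sigma>. (f \<sigma>) ^ 3) \<sigma>\<bar>) \<le> 3 * V * d i" if i: "i \<in> {1..N}" for i
  proof -
    have "\<bar>(f \<sigma>) ^ 3 - resample i (\<lambda>\<sigma>. (f \<sigma>) ^ 3) \<sigma>\<bar>
      \<le> d i * (3 / 2) * ((f \<sigma>)\<^sup>2 + resample i (\<lambda>\<sigma>. (f \<sigma>)\<^sup>2) \<sigma>)" if \<sigma>: "\<sigma> \<in> spin_configs N" for \<sigma>
    proof -
      define t where "t = cond_mean i \<sigma>"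
      define a where "a = f \<sigma>"
      define b where "b s = f (\<sigma>(i := s))" for s
      have t: "0 \<le> (1 + t) / 2" "0 \<le> (1 - t) / 2"
        using cond_mean_bounds[of i \<sigma>] by (auto simp: t_def)
      have ab: "\<bar>a ^ 3 - b s ^ 3\<bar> \<le> d i * (3 / 2 * (a\<^sup>2 + (b s)\<^sup>2))" if "s = 1 \<or> s = -1" for s
        using abs_diff_update_le[OF f i \<sigma> that]
        by (intro order_trans[OF cube] mult_right_mono) (auto simp: a_def b_def abs_minus_commute)
      have "\<bar>a ^ 3 - ((1 + t) / 2 * b 1 ^ 3 + (1 - t) / 2 * b (-1) ^ 3)\<bar>
        = \<bar>(1 + t) / 2 * (a ^ 3 - b 1 ^ 3) + (1 - t) / 2 * (a ^ 3 - b (-1) ^ 3)\<bar>"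
        by (intro arg_cong[of _ _ abs]) (simp add: field_simps)
      also have "\<dots> \<le> (1 + t) / 2 * \<bar>a ^ 3 - b 1 ^ 3\<bar> + (1 - t) / 2 * \<bar>a ^ 3 - b (-1) ^ 3\<bar>"
        by (rule order_trans[OF abs_triangle_ineq]) (use t in \<open>simp add: abs_mult\<close>)
      also have "\<dots> \<le> (1 + t) / 2 * (d i * (3 / 2 * (a\<^sup>2 + (b 1)\<^sup>2)))
          + (1 - t) / 2 * (d i * (3 / 2 * (a\<^sup>2 + (b (-1))\<^sup>2)))"
        using t ab by (intro add_mono mult_left_mono) auto
      also have "\<dots> = d i * (3 / 2) * (a\<^sup>2 + ((1 + t) / 2 * (b 1)\<^sup>2 + (1 - t) / 2 * (b (-1))\<^sup>2))"
        by (simp add: field_simps)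
      finally show ?thesis
        by (simp add: resample_def a_def b_def t_def)
    qed
    then have "expect (\<lambda>\<sigma>. \<bar>(f \<sigma>) ^ 3 - resample i (\<lambda>\<sigma>. (f \<sigma>) ^ 3) \<sigma>\<bar>)
      \<le> expect (\<lambda>\<sigma>. d i * (3 / 2) * ((f \<sigma>)\<^sup>2 + resample i (\<lambda>\<sigma>. (f \<sigma>)\<^sup>2) \<sigma>))"
      by (rule expect_mono)
    also have "\<dots> = 3 * V * d i"
      unfolding expect_cmult expect_add expect_resample[OF i] V_def by simp
    finally show ?thesis .
  qed
  then have "\<bar>expect (\<lambda>\<sigma>. f \<sigma> * (f \<sigma>) ^ 3)\<bar>
    \<le> L2_set d {1..N} * L2_set (\<lambda>i. 3 * V * d i) {1..N} / gap"
    by (rule covariance_le[OF assms])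
  also have "L2_set (\<lambda>i. 3 * V * d i) {1..N} = 3 * V * L2_set d {1..N}"
    using expect_nonneg[of "\<lambda>\<sigma>. (f \<sigma>)\<^sup>2"] by (simp add: L2_set_right_distrib V_def)
  also have "L2_set d {1..N} * (3 * V * L2_set d {1..N}) / gap = 3 * V * (D / gap)"
    unfolding D_def L2_set_def by (simp add: sum_nonneg)
  also have "\<dots> \<le> 3 * (D / gap) * (D / gap)"
    using second_moment_le[OF assms] D gap_pos by (intro mult_right_mono) (auto simp: V_def D_def)
  finally show ?thesis
    by (simp add: D_def power2_eq_square numeral_eq_Suc mult_ac)
qed

end

section \<open>Stein's method for the magnetization\<close>

context subcritical_ising
begin

text \<open>At zero field the weight is invariant under the simultaneous negation of all
  spins.\<close>

lemma expect_spin: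
  assumes "i \<in> {1..N}"
  shows "expect (\<lambda>\<sigma>. \<sigma> i) = 0"
proof -
  \<comment> \<open>The restriction keeps the default value outside \<open>{1..N}\<close>, so that
    the negated configuration is again an element of \<open>spin_configs N\<close>.\<close>
  define neg where "neg \<sigma> = restrict (\<lambda>j. - \<sigma> j) {1..N}" for \<sigma> :: "nat \<Rightarrow> real"
  have mem: "neg \<sigma> \<in> spin_configs N" if "\<sigma> \<in> spin_configs N" for \<sigma>
    using that by (auto simp: neg_def spin_configs_def PiE_iff)
  have inv: "neg (neg \<sigma>) = \<sigma>" if "\<sigma> \<in> spin_configs N" for \<sigma>
    using that by (auto simp: neg_def spin_configs_def fun_eq_iff PiE_def extensional_def)
  have "bij_betw neg (spin_configs N) (spin_configs N)"
    by (rule bij_betw_byWitness[where f' = neg]) (use mem inv in auto)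
  then have "expect (\<lambda>\<sigma>. \<sigma> i) = (\<Sum>\<sigma>\<in>spin_configs N. prob (neg \<sigma>) * neg \<sigma> i)"
    unfolding expect_def by (rule sum.reindex_bij_betw[symmetric])
  moreover have "prob (neg \<sigma>) = prob \<sigma>" for \<sigma>
  proof -
    have "(\<Sum>i=1..N. \<Sum>j=1..N. neg \<sigma> i * A i j * neg \<sigma> j) = (\<Sum>i=1..N. \<Sum>j=1..N. \<sigma> i * A i j * \<sigma> j)"
      by (intro sum.cong refl) (simp add: neg_def)
    then show ?thesis by (simp add: prob_def ising_weight_def)
  qed
  ultimately have "expect (\<lambda>\<sigma>. \<sigma> i) = - expect (\<lambda>\<sigma>. \<sigma> i)"
    using assms by (simp add: expect_def neg_def sum_negf)
  then show ?thesis by simp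
qed

lemma expect_linear: "expect (\<lambda>\<sigma>. \<Sum>j=1..N. c j * \<sigma> j) = 0"
  using expect_spin by (simp add: expect_sum expect_cmult)

lemma osc_linear: "osc_le (\<lambda>\<sigma>. \<Sum>j=1..N. c j * \<sigma> j) (\<lambda>k. 2 * \<bar>c k\<bar>)"
  unfolding osc_le_def
proof (intro ballI)
  fix k and \<sigma> :: "nat \<Rightarrow> real" assume k: "k \<in> {1..N}"
  have "(\<Sum>j=1..N. c j * (\<sigma>(k := 1)) j) - (\<Sum>j=1..N. c j * (\<sigma>(k := -1)) j)
    = (\<Sum>j=1..N. if j = k then 2 * c k else 0)"
    unfolding sum_subtractf[symmetric] by (intro sum.cong) auto
  also have "\<dots> = 2 * c k" using k by simp
  finally show "\<bar>(\<Sum>j=1..N. c j * (\<sigma>(k := 1)) j) - (\<Sum>j=1..N. c j * (\<sigma>(k := -1)) j)\<bar> \<le> 2 * \<bar>c k\<bar>"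
    by (simp add: abs_mult)
qed

lemma second_moment_linear:
  "expect (\<lambda>\<sigma>. (\<Sum>j=1..N. c j * \<sigma> j)\<^sup>2) \<le> 4 / gap * (\<Sum>j=1..N. (c j)\<^sup>2)"
  using second_moment_le[OF osc_linear expect_linear, of c]
  by (simp add: power_mult_distrib flip: sum_distrib_left)

lemma fourth_moment_linear:
  "expect (\<lambda>\<sigma>. (\<Sum>j=1..N. c j * \<sigma> j) ^ 4) \<le> 3 * (4 / gap * (\<Sum>j=1..N. (c j)\<^sup>2))\<^sup>2"
  using fourth_moment_le[OF osc_linear expect_linear, of c]
  by (simp add: power_mult_distrib flip: sum_distrib_left)

text \<open>Interpolation between the second and fourth moments by 2 s |x|^3 <= x^4 + s^2 x^2. The
  scale \<open>s\<close> is left free so that one value can serve all rows of the matrix.\<close>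

lemma third_moment_linear:
  assumes "0 < s" and V: "4 / gap * (\<Sum>j=1..N. (c j)\<^sup>2) \<le> s\<^sup>2"
  shows "expect (\<lambda>\<sigma>. \<bar>\<Sum>j=1..N. c j * \<sigma> j\<bar> ^ 3) \<le> 2 * s * (4 / gap * (\<Sum>j=1..N. (c j)\<^sup>2))"
proof -
  define V where "V = 4 / gap * (\<Sum>j=1..N. (c j)\<^sup>2)"
  define f where "f \<sigma> = (\<Sum>j=1..N. c j * \<sigma> j)" for \<sigma>
  have V0: "0 \<le> V" using gap_pos by (simp add: V_def sum_nonneg)
  have "2 * s * \<bar>x\<bar> ^ 3 \<le> x ^ 4 + s\<^sup>2 * x\<^sup>2" for x :: real
  proof -
    have "0 \<le> (x\<^sup>2 - s * \<bar>x\<bar>)\<^sup>2" by simp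
    also have "\<dots> = x ^ 4 + s\<^sup>2 * x\<^sup>2 - 2 * s * \<bar>x\<bar> ^ 3"
      by (simp add: power2_diff power_mult_distrib) (simp add: power3_eq_cube power2_eq_square numeral_eq_Suc)
    finally show ?thesis by simp
  qed
  then have "expect (\<lambda>\<sigma>. 2 * s * \<bar>f \<sigma>\<bar> ^ 3) \<le> expect (\<lambda>\<sigma>. (f \<sigma>) ^ 4 + s\<^sup>2 * (f \<sigma>)\<^sup>2)"
    by (intro expect_mono) blast
  then have "2 * s * expect (\<lambda>\<sigma>. \<bar>f \<sigma>\<bar> ^ 3) \<le> expect (\<lambda>\<sigma>. (f \<sigma>) ^ 4) + s\<^sup>2 * expect (\<lambda>\<sigma>. (f \<sigma>)\<^sup>2)"
    by (simp add: expect_cmult expect_add)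
  also have "\<dots> \<le> 3 * V\<^sup>2 + s\<^sup>2 * V"
    unfolding f_def V_def by (intro add_mono mult_left_mono fourth_moment_linear second_moment_linear) simp
  also have "\<dots> \<le> 3 * (s\<^sup>2 * V) + s\<^sup>2 * V"
    using mult_right_mono[OF V[folded V_def] V0] by (simp add: power2_eq_square[of V] mult.commute)
  finally have "2 * s * expect (\<lambda>\<sigma>. \<bar>f \<sigma>\<bar> ^ 3) \<le> 2 * s * (2 * s * V)"
    by (simp add: power2_eq_square mult_ac)
  then have "expect (\<lambda>\<sigma>. \<bar>f \<sigma>\<bar> ^ 3) \<le> 2 * s * V"
    by (rule mult_left_le_imp_le) (use assms(1) in simp)
  then show ?thesis by (simp only: f_def V_def)
qed

section \<open>The Stein identity for the normalized magnetization\<close>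

definition magn :: "(nat \<Rightarrow> real) \<Rightarrow> real" where
  "magn \<sigma> = (\<Sum>i=1..N. \<sigma> i) / sqrt (real N)"

text \<open>By symmetry of the matrix this equals the sum of the conditional means minus \<beta>
  times the sum of the spins, divided by sqrt N. The first part measures row sums different from 1,
  the second the linearization of tanh.\<close>

definition drift_error :: "(nat \<Rightarrow> real) \<Rightarrow> real" where
  "drift_error \<sigma> = (\<beta> * (\<Sum>j=1..N. (row_sum N A j - 1) * \<sigma> j)
     - (\<Sum>i=1..N. \<beta> * local_field i \<sigma> - cond_mean i \<sigma>)) / sqrt (real N)"

definition mean_sq :: "(nat \<Rightarrow> real) \<Rightarrow> real" where
  "mean_sq \<sigma> = (\<Sum>i=1..N. (cond_mean i \<sigma>)\<^sup>2) / real N"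

lemma sum_spin_minus_cond_mean:
  "(\<Sum>i=1..N. \<sigma> i - cond_mean i \<sigma>) = sqrt (real N) * ((1 - \<beta>) * magn \<sigma> - drift_error \<sigma>)"
proof -
  have "(\<Sum>i=1..N. local_field i \<sigma>) = (\<Sum>j=1..N. \<Sum>i=1..N. A i j * \<sigma> j)"
    unfolding local_field_def by (rule sum.swap)
  also have "\<dots> = (\<Sum>j=1..N. \<Sum>i=1..N. A j i * \<sigma> j)"
    by (intro sum.cong refl) (metis A_sym)
  also have "\<dots> = (\<Sum>j=1..N. row_sum N A j * \<sigma> j)"
    by (simp add: row_sum_def sum_distrib_right)
  finally have "(\<Sum>i=1..N. local_field i \<sigma>) = (\<Sum>j=1..N. row_sum N A j * \<sigma> j)" .
  moreover have "sqrt (real N) * ((1 - \<beta>) * (a / sqrt (real N)) - b / sqrt (real N)) = (1 - \<beta>) * a - b" for a b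
    using N_pos by (simp add: right_diff_distrib[of "sqrt (real N)"])
  ultimately show ?thesis
    unfolding magn_def drift_error_def
    by (simp add: sum_subtractf left_diff_distrib right_diff_distrib[of \<beta>] flip: sum_distrib_left)
qed

lemma magn_update:
  assumes "i \<in> {1..N}"
  shows "magn (\<sigma>(i := s)) = magn \<sigma> + (s - \<sigma> i) / sqrt (real N)"
proof -
  have "(\<Sum>j=1..N. (\<sigma>(i := s)) j) = (\<Sum>j=1..N. \<sigma> j + (if j = i then s - \<sigma> i else 0))"
    by (intro sum.cong) auto
  also have "\<dots> = (\<Sum>j=1..N. \<sigma> j) + (s - \<sigma> i)"
    using assms by (simp add: sum.distrib)
  finally show ?thesis by (simp add: magn_def add_divide_distrib)
qed

text \<open>Reduces the distance at \<open>z\<close> to first moments. The discrete integration by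
  parts for \<open>f (magn \<sigma>)\<close> is compared with the Stein equation; both bounds on
  \<open>L\<close> are needed to dominate \<open>f\<close>, \<open>f'\<close> and the expansion
  error.\<close>

lemma kolmogorov_le_moments:
  fixes z L :: real
  defines "v \<equiv> 1 / (1 - \<beta>)"
  assumes "\<beta> < 1"
    and L1: "4 + 2 / v + (v + 1 / normal_density 0 (sqrt v) 1) / v \<le> L"
    and L2: "v + 1 / normal_density 0 (sqrt v) 1 \<le> L"
  shows "\<bar>expect (\<lambda>\<sigma>. of_bool (magn \<sigma> \<le> z)) - cdf (normal_measure 0 v) z\<bar>
    \<le> L * (expect (\<lambda>\<sigma>. \<bar>drift_error \<sigma>\<bar>) + expect mean_sq + 2 / sqrt (real N) * (1 + expect (\<lambda>\<sigma>. \<bar>magn \<sigma>\<bar>))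
        + 2 / sqrt (real N) * ((1 - \<beta>) * expect (\<lambda>\<sigma>. \<bar>magn \<sigma>\<bar>) + expect (\<lambda>\<sigma>. \<bar>drift_error \<sigma>\<bar>)))"
proof -
  have v: "0 < v" using assms by (simp add: v_def)
  interpret normal: real_distribution "normal_measure 0 v"
    by (rule real_distribution_normal_measure[OF v])
  define p where "p = cdf (normal_measure 0 v) z"
  define f where "f = stein_solution v z"
  \<comment> \<open>The derivative prescribed by the Stein equation; at \<open>z\<close> itself this
    is the left derivative.\<close>
  define f' where "f' w = w / v * f w + of_bool (w \<le> z) - p" for w
  define q where "q = sqrt (real N)"
  define Y where "Y \<sigma> = (1 - \<beta>) * magn \<sigma> - drift_error \<sigma>" for \<sigma>
  define a where "a i \<sigma> = (1 - (cond_mean i \<sigma>)\<^sup>2) / 2" for i \<sigma>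
  define D where "D i \<sigma> = f (magn (\<sigma>(i := 1))) - f (magn (\<sigma>(i := -1)))" for i \<sigma>
  \<comment> \<open>Equal to 1 exactly when changing spin \<open>i\<close> moves the magnetization
    across \<open>z\<close>, and 0 otherwise, since the magnetization is increasing in that
    spin.\<close>
  define I :: "nat \<Rightarrow> (nat \<Rightarrow> real) \<Rightarrow> real"
    where "I i \<sigma> = of_bool (magn (\<sigma>(i := -1)) \<le> z) - of_bool (magn (\<sigma>(i := 1)) \<le> z)" for i \<sigma>
  define J where "J \<sigma> = (of_bool (magn \<sigma> \<le> z) :: real)" for \<sigma>
  have q: "0 < q" "q * q = real N" using N_pos by (auto simp: q_def)
  have L: "0 \<le> L"
    using L2 v normal_density_pos[of "sqrt v" 0 1] by (smt (verit) divide_nonneg_pos real_sqrt_gt_zero)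
  have "0 \<le> 2 / v + (v + 1 / normal_density 0 (sqrt v) 1) / v"
    using v normal_density_pos[of "sqrt v" 0 1] by (intro add_nonneg_nonneg divide_nonneg_pos) auto
  then have L4: "4 \<le> L" using L1 by linarith
  have f_bound: "\<bar>f w\<bar> \<le> L" for w
    using stein_solution_bounds(1,2)[OF v, of z w] L2 by (simp add: f_def)
  have f'_bound: "\<bar>f' w\<bar> \<le> L" for w
  proof -
    have "0 \<le> (of_bool (w \<le> z) :: real)" "(of_bool (w \<le> z) :: real) \<le> 1" by auto
    then show ?thesis
      using stein_solution_bounds(3)[OF v, of w z] normal.cdf_nonneg[of z] normal.cdf_bounded_prob[of z] L4
      unfolding f'_def p_def f_def by argo
  qed
  have a: "0 \<le> a i \<sigma>" "a i \<sigma> \<le> 1 / 2" for i \<sigma>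
    using cond_mean_sq_le_1[of i \<sigma>] by (auto simp: a_def)
  \<comment> \<open>Multiplied by the step length 2 / q this is q * (1 - mean_sq \<sigma>), the
    coefficient of \<open>f'\<close> in the expansion.\<close>
  have sum_a: "(\<Sum>i=1..N. a i \<sigma>) = real N / 2 * (1 - mean_sq \<sigma>)" for \<sigma>
    using N_pos by (simp add: a_def mean_sq_def sum_subtractf field_simps flip: sum_divide_distrib)
  have sum_Y: "(\<Sum>i=1..N. \<sigma> i - cond_mean i \<sigma>) = q * Y \<sigma>" for \<sigma>
    unfolding Y_def q_def by (rule sum_spin_minus_cond_mean)
  have incr: "\<bar>D i \<sigma> - 2 / q * f' (magn \<sigma>)\<bar> \<le> L * (2 / q) * ((1 + \<bar>magn \<sigma>\<bar>) * (2 / q) + I i \<sigma>)"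
    if i: "i \<in> {1..N}" and \<sigma>: "\<sigma> \<in> spin_configs N" for i \<sigma>
  proof -
    have len: "magn (\<sigma>(i := 1)) - magn (\<sigma>(i := -1)) = 2 / q"
      unfolding magn_update[OF i] q_def by (simp add: diff_divide_distrib[symmetric] add_divide_distrib[symmetric])
    have "\<sigma> i = 1 \<or> \<sigma> i = -1" using spin_configs_cases[OF \<sigma> i] by metis
    then have "magn (\<sigma>(i := -1)) \<le> magn \<sigma>" "magn \<sigma> \<le> magn (\<sigma>(i := 1))"
      unfolding magn_update[OF i] by auto
    from stein_solution_increment[OF v this L1, of z] show ?thesis
      unfolding len D_def I_def f'_def f_def p_def .
  qed
  have by_parts: "expect (\<lambda>\<sigma>. q * Y \<sigma> * g \<sigma>) = expect (\<lambda>\<sigma>. \<Sum>i=1..N. a i \<sigma> * (g (\<sigma>(i := 1)) - g (\<sigma>(i := -1))))" for g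
    unfolding sum_Y[symmetric] sum_distrib_right expect_sum a_def
    by (intro sum.cong expect_spin_minus_cond_mean) auto
  have Ef: "expect (\<lambda>\<sigma>. q * Y \<sigma> * f (magn \<sigma>)) = expect (\<lambda>\<sigma>. \<Sum>i=1..N. a i \<sigma> * D i \<sigma>)"
    unfolding D_def by (rule by_parts[of "\<lambda>\<sigma>. f (magn \<sigma>)"])
  \<comment> \<open>The crossings of \<open>z\<close> are counted by the same integration by parts,
    now for minus the indicator \<open>J\<close>; this takes the place of a concentration
    inequality.\<close>
  have EI: "expect (\<lambda>\<sigma>. \<Sum>i=1..N. a i \<sigma> * I i \<sigma>) \<le> q * expect (\<lambda>\<sigma>. \<bar>Y \<sigma>\<bar>)"
  proof -
    have "expect (\<lambda>\<sigma>. \<Sum>i=1..N. a i \<sigma> * I i \<sigma>) = expect (\<lambda>\<sigma>. q * Y \<sigma> * - J \<sigma>)"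
      unfolding by_parts by (simp add: I_def J_def)
    also have "\<dots> \<le> expect (\<lambda>\<sigma>. q * \<bar>Y \<sigma>\<bar>)"
    proof (rule expect_mono)
      fix \<sigma>
      have "Y \<sigma> * - J \<sigma> \<le> \<bar>Y \<sigma>\<bar>" by (simp add: J_def abs_if)
      then show "q * Y \<sigma> * - J \<sigma> \<le> q * \<bar>Y \<sigma>\<bar>"
        using q(1) by (simp only: mult.assoc mult_left_mono less_imp_le)
    qed
    finally show ?thesis by (simp add: expect_cmult)
  qed
  have pointwise: "\<bar>(\<Sum>i=1..N. a i \<sigma> * D i \<sigma>) - q * (1 - mean_sq \<sigma>) * f' (magn \<sigma>)\<bar>
      \<le> 2 * L * (1 + \<bar>magn \<sigma>\<bar>) + 2 * L / q * (\<Sum>i=1..N. a i \<sigma> * I i \<sigma>)"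
    if \<sigma>: "\<sigma> \<in> spin_configs N" for \<sigma>
  proof -
    have eq': "q * (1 - mean_sq \<sigma>) * f' (magn \<sigma>) = (\<Sum>i=1..N. a i \<sigma>) * (2 / q * f' (magn \<sigma>))"
      unfolding sum_a q(2)[symmetric] using q(1) by (simp add: field_simps)
    have eq: "(\<Sum>i=1..N. a i \<sigma> * D i \<sigma>) - q * (1 - mean_sq \<sigma>) * f' (magn \<sigma>)
      = (\<Sum>i=1..N. a i \<sigma> * (D i \<sigma> - 2 / q * f' (magn \<sigma>)))"
      unfolding eq' by (simp only: right_diff_distrib sum_subtractf sum_distrib_right)
    have "\<bar>(\<Sum>i=1..N. a i \<sigma> * D i \<sigma>) - q * (1 - mean_sq \<sigma>) * f' (magn \<sigma>)\<bar>
      \<le> (\<Sum>i=1..N. a i \<sigma> * (L * (2 / q) * ((1 + \<bar>magn \<sigma>\<bar>) * (2 / q) + I i \<sigma>)))"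
      unfolding eq
    proof (intro order_trans[OF sum_abs] sum_mono)
      fix i assume "i \<in> {1..N}"
      from mult_left_mono[OF incr[OF this \<sigma>] a(1)[of i \<sigma>]]
      show "\<bar>a i \<sigma> * (D i \<sigma> - 2 / q * f' (magn \<sigma>))\<bar>
        \<le> a i \<sigma> * (L * (2 / q) * ((1 + \<bar>magn \<sigma>\<bar>) * (2 / q) + I i \<sigma>))"
        by (simp only: abs_mult abs_of_nonneg[OF a(1)[of i \<sigma>]])
    qed
    also have "\<dots> = L * (4 / real N) * (1 + \<bar>magn \<sigma>\<bar>) * (\<Sum>i=1..N. a i \<sigma>)
        + 2 * L / q * (\<Sum>i=1..N. a i \<sigma> * I i \<sigma>)"
      unfolding q(2)[symmetric] sum_distrib_left sum.distrib[symmetric] using q(1)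
      by (intro sum.cong) (simp_all add: field_simps)
    also have "\<dots> \<le> L * (4 / real N) * (1 + \<bar>magn \<sigma>\<bar>) * (\<Sum>i=1..N. 1 / 2)
        + 2 * L / q * (\<Sum>i=1..N. a i \<sigma> * I i \<sigma>)"
      using L a by (intro add_right_mono mult_left_mono sum_mono) auto
    also have "\<dots> = 2 * L * (1 + \<bar>magn \<sigma>\<bar>) + 2 * L / q * (\<Sum>i=1..N. a i \<sigma> * I i \<sigma>)"
      using N_pos by simp
    finally show ?thesis .
  qed
  \<comment> \<open>With 1 / v = 1 - \<beta>, the Stein equation turns f' - magn * f / v into
    \<open>J \<sigma> - p\<close>; what is left over is the variance and the drift error.\<close>
  have eq: "q * expect (\<lambda>\<sigma>. mean_sq \<sigma> * f' (magn \<sigma>) - drift_error \<sigma> * f (magn \<sigma>) - (J \<sigma> - p))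
    = expect (\<lambda>\<sigma>. (\<Sum>i=1..N. a i \<sigma> * D i \<sigma>) - q * (1 - mean_sq \<sigma>) * f' (magn \<sigma>))"
    unfolding expect_diff[of "\<lambda>\<sigma>. \<Sum>i=1..N. a i \<sigma> * D i \<sigma>"] Ef[symmetric] expect_diff[symmetric] expect_cmult[symmetric]
    by (intro expect_cong) (simp add: Y_def f'_def J_def v_def algebra_simps)
  have "\<bar>q * expect (\<lambda>\<sigma>. mean_sq \<sigma> * f' (magn \<sigma>) - drift_error \<sigma> * f (magn \<sigma>) - (J \<sigma> - p))\<bar> \<le> expect (\<lambda>\<sigma>. 2 * L * (1 + \<bar>magn \<sigma>\<bar>) + 2 * L / q * (\<Sum>i=1..N. a i \<sigma> * I i \<sigma>))"
    unfolding eq by (intro order_trans[OF abs_expect_le] expect_mono pointwise)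
  also have "\<dots> = 2 * L * (1 + expect (\<lambda>\<sigma>. \<bar>magn \<sigma>\<bar>)) + 2 * L / q * expect (\<lambda>\<sigma>. \<Sum>i=1..N. a i \<sigma> * I i \<sigma>)"
    by (simp only: expect_add expect_cmult expect_const)
  also have "\<dots> \<le> 2 * L * (1 + expect (\<lambda>\<sigma>. \<bar>magn \<sigma>\<bar>)) + 2 * L / q * (q * expect (\<lambda>\<sigma>. \<bar>Y \<sigma>\<bar>))"
    using L q by (intro add_left_mono mult_left_mono EI) auto
  also have "\<dots> = 2 * L * (1 + expect (\<lambda>\<sigma>. \<bar>magn \<sigma>\<bar>)) + 2 * L * expect (\<lambda>\<sigma>. \<bar>Y \<sigma>\<bar>)"
    using q by simp
  finally have main: "q * \<bar>expect (\<lambda>\<sigma>. mean_sq \<sigma> * f' (magn \<sigma>) - drift_error \<sigma> * f (magn \<sigma>) - (J \<sigma> - p))\<bar>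
    \<le> 2 * L * (1 + expect (\<lambda>\<sigma>. \<bar>magn \<sigma>\<bar>)) + 2 * L * expect (\<lambda>\<sigma>. \<bar>Y \<sigma>\<bar>)"
    using q by (simp add: abs_mult)
  have EY: "expect (\<lambda>\<sigma>. \<bar>Y \<sigma>\<bar>) \<le> (1 - \<beta>) * expect (\<lambda>\<sigma>. \<bar>magn \<sigma>\<bar>) + expect (\<lambda>\<sigma>. \<bar>drift_error \<sigma>\<bar>)"
    unfolding expect_cmult[symmetric] expect_add[symmetric] Y_def using assms(2)
    by (intro expect_mono order_trans[OF abs_triangle_ineq4]) (simp add: abs_mult)
  have "\<bar>expect (\<lambda>\<sigma>. mean_sq \<sigma> * f' (magn \<sigma>) - drift_error \<sigma> * f (magn \<sigma>) - (J \<sigma> - p))\<bar>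
    \<le> (2 * L * (1 + expect (\<lambda>\<sigma>. \<bar>magn \<sigma>\<bar>)) + 2 * L * expect (\<lambda>\<sigma>. \<bar>Y \<sigma>\<bar>)) / q"
    using main q by (simp add: field_simps)
  also have "\<dots> \<le> (2 * L * (1 + expect (\<lambda>\<sigma>. \<bar>magn \<sigma>\<bar>))
      + 2 * L * ((1 - \<beta>) * expect (\<lambda>\<sigma>. \<bar>magn \<sigma>\<bar>) + expect (\<lambda>\<sigma>. \<bar>drift_error \<sigma>\<bar>))) / q"
    using L q by (intro divide_right_mono add_left_mono mult_left_mono EY) auto
  also have "\<dots> = L * (2 / q * (1 + expect (\<lambda>\<sigma>. \<bar>magn \<sigma>\<bar>))
      + 2 / q * ((1 - \<beta>) * expect (\<lambda>\<sigma>. \<bar>magn \<sigma>\<bar>) + expect (\<lambda>\<sigma>. \<bar>drift_error \<sigma>\<bar>)))"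
    using q(1) by (simp add: field_simps)
  finally have main': "\<bar>expect (\<lambda>\<sigma>. mean_sq \<sigma> * f' (magn \<sigma>)) - expect (\<lambda>\<sigma>. drift_error \<sigma> * f (magn \<sigma>)) - (expect J - p)\<bar>
    \<le> L * (2 / q * (1 + expect (\<lambda>\<sigma>. \<bar>magn \<sigma>\<bar>))
      + 2 / q * ((1 - \<beta>) * expect (\<lambda>\<sigma>. \<bar>magn \<sigma>\<bar>) + expect (\<lambda>\<sigma>. \<bar>drift_error \<sigma>\<bar>)))"
    by (simp only: expect_diff expect_const)
  have "\<bar>expect (\<lambda>\<sigma>. mean_sq \<sigma> * f' (magn \<sigma>))\<bar> \<le> expect (\<lambda>\<sigma>. L * mean_sq \<sigma>)"
  proof (intro order_trans[OF abs_expect_le] expect_mono)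
    fix \<sigma>
    have "0 \<le> mean_sq \<sigma>" by (simp add: mean_sq_def sum_nonneg)
    then show "\<bar>mean_sq \<sigma> * f' (magn \<sigma>)\<bar> \<le> L * mean_sq \<sigma>"
      using f'_bound[of "magn \<sigma>"] by (simp add: abs_mult mult.commute mult_right_mono)
  qed
  moreover have "\<bar>expect (\<lambda>\<sigma>. drift_error \<sigma> * f (magn \<sigma>))\<bar> \<le> expect (\<lambda>\<sigma>. L * \<bar>drift_error \<sigma>\<bar>)"
    using f_bound
    by (intro order_trans[OF abs_expect_le] expect_mono) (simp add: abs_mult mult.commute mult_right_mono)
  ultimately have "\<bar>expect J - p\<bar> \<le> L * (expect (\<lambda>\<sigma>. \<bar>drift_error \<sigma>\<bar>)) + L * expect mean_sq
      + L * (2 / q * (1 + expect (\<lambda>\<sigma>. \<bar>magn \<sigma>\<bar>))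
      + 2 / q * ((1 - \<beta>) * expect (\<lambda>\<sigma>. \<bar>magn \<sigma>\<bar>) + expect (\<lambda>\<sigma>. \<bar>drift_error \<sigma>\<bar>)))"
    using main' unfolding expect_cmult by argo
  then show ?thesis
    by (simp only: J_def[abs_def] p_def q_def distrib_left add.assoc)
qed

section \<open>Bounds for the error terms\<close>

lemma expect_abs_magn_le: "expect (\<lambda>\<sigma>. \<bar>magn \<sigma>\<bar>) \<le> sqrt (4 / gap)"
proof -
  have "expect (\<lambda>\<sigma>. (magn \<sigma>)\<^sup>2) \<le> 4 / gap * (\<Sum>j=1..N. (1 / sqrt (real N))\<^sup>2)"
    using second_moment_linear[of "\<lambda>_. 1 / sqrt (real N)"] by (simp add: magn_def sum_divide_distrib)
  also have "\<dots> = 4 / gap" using N_pos by (simp add: power_divide)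
  finally show ?thesis
    using expect_abs_le_sqrt[of magn] by (meson order_trans real_sqrt_le_mono)
qed

lemma row_sq_le_max_row_sq:
  assumes "i \<in> {1..N}"
  shows "(\<Sum>j=1..N. (A i j)\<^sup>2) \<le> max_row_sq N A"
  unfolding max_row_sq_def using assms by (intro Max_ge) auto

lemma frobenius_norm_sq: "(frobenius_norm N A)\<^sup>2 = (\<Sum>i=1..N. \<Sum>j=1..N. (A i j)\<^sup>2)"
  unfolding frobenius_norm_def by (intro real_sqrt_pow2 sum_nonneg) auto

text \<open>The row-sum part is a linear statistic and is bounded by its second moment. The tanh
  part is at most the sum of the cubed local fields, each bounded by a third moment; summing the
  squared rows produces the Frobenius norm.\<close>

lemma expect_abs_drift_error_le:
  assumes "\<beta> < 1" "0 < max_row_sq N A"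
  shows "expect (\<lambda>\<sigma>. \<bar>drift_error \<sigma>\<bar>)
    \<le> sqrt (4 / gap) * sqrt ((\<Sum>i=1..N. (row_sum N A i - 1)\<^sup>2) / real N)
      + 2 * sqrt (4 / gap) * (4 / gap) * ((frobenius_norm N A)\<^sup>2 * sqrt (max_row_sq N A) / sqrt (real N))"
proof -
  define c where "c = 4 / gap"
  define q where "q = sqrt (real N)"
  define S where "S = (\<Sum>j=1..N. (row_sum N A j - 1)\<^sup>2)"
  \<comment> \<open>Chosen so that s^2 bounds the second moments of all local fields
    simultaneously.\<close>
  define s where "s = sqrt c * sqrt (max_row_sq N A)"
  have c: "0 < c" using gap_pos by (simp add: c_def)
  have q: "0 < q" using N_pos by (simp add: q_def)
  have s: "0 < s" "s\<^sup>2 = c * max_row_sq N A"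
    using c assms by (simp_all add: s_def power_mult_distrib)
  have linear: "expect (\<lambda>\<sigma>. \<bar>\<Sum>j=1..N. (row_sum N A j - 1) * \<sigma> j\<bar>) \<le> sqrt (c * S)"
    using expect_abs_le_sqrt[of "\<lambda>\<sigma>. \<Sum>j=1..N. (row_sum N A j - 1) * \<sigma> j"]
      real_sqrt_le_mono[OF second_moment_linear[of "\<lambda>j. row_sum N A j - 1"]]
    unfolding c_def S_def by linarith
  have cubic: "expect (\<lambda>\<sigma>. \<bar>\<beta> * local_field i \<sigma> - cond_mean i \<sigma>\<bar>) \<le> 2 * s * (c * (\<Sum>j=1..N. (A i j)\<^sup>2))"
    if i: "i \<in> {1..N}" for i
  proof -
    have "\<bar>\<beta> * local_field i \<sigma> - cond_mean i \<sigma>\<bar> \<le> \<bar>local_field i \<sigma>\<bar> ^ 3" for \<sigma>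
    proof -
      have "\<bar>\<beta> * local_field i \<sigma>\<bar> \<le> \<bar>local_field i \<sigma>\<bar>"
        using assms beta_pos by (simp add: abs_mult mult_left_le_one_le)
      then have "\<bar>\<beta> * local_field i \<sigma>\<bar> ^ 3 \<le> \<bar>local_field i \<sigma>\<bar> ^ 3"
        by (rule power_mono) simp
      then show ?thesis
        unfolding cond_mean_def by (rule order_trans[OF abs_tanh_diff_le_cube])
    qed
    then have "expect (\<lambda>\<sigma>. \<bar>\<beta> * local_field i \<sigma> - cond_mean i \<sigma>\<bar>) \<le> expect (\<lambda>\<sigma>. \<bar>local_field i \<sigma>\<bar> ^ 3)"
      by (intro expect_mono)
    also have "\<dots> \<le> 2 * s * (c * (\<Sum>j=1..N. (A i j)\<^sup>2))"
      unfolding local_field_def c_def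
    proof (rule third_moment_linear[OF s(1)])
      show "4 / gap * (\<Sum>j=1..N. (A i j)\<^sup>2) \<le> s\<^sup>2"
        using row_sq_le_max_row_sq[OF i] c unfolding s(2) c_def[symmetric] by (intro mult_left_mono) auto
    qed
    finally show ?thesis .
  qed
  have "expect (\<lambda>\<sigma>. \<bar>drift_error \<sigma>\<bar>)
    \<le> expect (\<lambda>\<sigma>. (\<bar>\<Sum>j=1..N. (row_sum N A j - 1) * \<sigma> j\<bar>
        + (\<Sum>i=1..N. \<bar>\<beta> * local_field i \<sigma> - cond_mean i \<sigma>\<bar>)) / q)"
  proof (rule expect_mono)
    fix \<sigma>
    define x where "x = (\<Sum>j=1..N. (row_sum N A j - 1) * \<sigma> j)"
    define y where "y = (\<Sum>i=1..N. \<beta> * local_field i \<sigma> - cond_mean i \<sigma>)"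
    have "\<bar>\<beta> * x\<bar> \<le> \<bar>x\<bar>"
      using assms beta_pos by (simp add: abs_mult mult_left_le_one_le)
    moreover have "\<bar>y\<bar> \<le> (\<Sum>i=1..N. \<bar>\<beta> * local_field i \<sigma> - cond_mean i \<sigma>\<bar>)"
      unfolding y_def by (rule sum_abs)
    ultimately have "\<bar>\<beta> * x - y\<bar> \<le> \<bar>x\<bar> + (\<Sum>i=1..N. \<bar>\<beta> * local_field i \<sigma> - cond_mean i \<sigma>\<bar>)"
      by argo
    then show "\<bar>drift_error \<sigma>\<bar> \<le> (\<bar>\<Sum>j=1..N. (row_sum N A j - 1) * \<sigma> j\<bar>
        + (\<Sum>i=1..N. \<bar>\<beta> * local_field i \<sigma> - cond_mean i \<sigma>\<bar>)) / q"
      unfolding drift_error_def x_def[symmetric] y_def[symmetric] q_def[symmetric]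
      using q by (simp add: divide_right_mono)
  qed
  also have "\<dots> \<le> (sqrt (c * S) + (\<Sum>i=1..N. 2 * s * (c * (\<Sum>j=1..N. (A i j)\<^sup>2)))) / q"
    unfolding expect_divide expect_add expect_sum
    using q by (intro divide_right_mono add_mono linear sum_mono cubic) auto
  also have "\<dots> = sqrt c * sqrt (S / real N) + 2 * sqrt c * c * ((frobenius_norm N A)\<^sup>2 * sqrt (max_row_sq N A) / q)"
    unfolding frobenius_norm_sq
    by (simp add: real_sqrt_mult real_sqrt_divide add_divide_distrib s_def q_def mult_ac flip: sum_distrib_left)
  finally show ?thesis by (simp add: c_def S_def q_def)
qed

text \<open>As |tanh x| <= |x| and \<beta> < 1, the squared conditional mean is at most the squared
  local field, whose second moment is known.\<close>

lemma expect_mean_sq_le: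
  assumes "\<beta> < 1"
  shows "expect mean_sq \<le> 4 / gap * ((frobenius_norm N A)\<^sup>2 / real N)"
proof -
  have "expect mean_sq = (\<Sum>i=1..N. expect (\<lambda>\<sigma>. (cond_mean i \<sigma>)\<^sup>2)) / real N"
    unfolding mean_sq_def[abs_def] by (simp add: expect_divide expect_sum)
  also have "\<dots> \<le> (\<Sum>i=1..N. 4 / gap * (\<Sum>j=1..N. (A i j)\<^sup>2)) / real N"
  proof (intro divide_right_mono sum_mono)
    fix i
    have "\<bar>cond_mean i \<sigma>\<bar> \<le> \<bar>local_field i \<sigma>\<bar>" for \<sigma>
    proof -
      have "\<bar>cond_mean i \<sigma>\<bar> \<le> \<bar>\<beta> * local_field i \<sigma>\<bar>"
        using tanh_real_lipschitz[of "\<beta> * local_field i \<sigma>" 0] by (simp add: cond_mean_def)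
      also have "\<dots> \<le> \<bar>local_field i \<sigma>\<bar>"
        using assms beta_pos by (simp add: abs_mult mult_left_le_one_le)
      finally show ?thesis .
    qed
    then have "expect (\<lambda>\<sigma>. (cond_mean i \<sigma>)\<^sup>2) \<le> expect (\<lambda>\<sigma>. (local_field i \<sigma>)\<^sup>2)"
      by (intro expect_mono) (simp add: abs_le_square_iff)
    also have "\<dots> \<le> 4 / gap * (\<Sum>j=1..N. (A i j)\<^sup>2)"
      unfolding local_field_def by (rule second_moment_linear)
    finally show "expect (\<lambda>\<sigma>. (cond_mean i \<sigma>)\<^sup>2) \<le> 4 / gap * (\<Sum>j=1..N. (A i j)\<^sup>2)" .
  qed simp
  finally show ?thesis
    unfolding frobenius_norm_sq sum_distrib_left[symmetric] by (simp only: times_divide_eq_right)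
qed

text \<open>If all row sums were below 1/2, every deviation from 1 would exceed 1/2, and so would
  their root mean square. For a row with sum at least 1/2, Cauchy-Schwarz gives 1/4 <= N times its
  sum of squares.\<close>

lemma max_row_sq_lower_bound:
  assumes "sqrt ((\<Sum>i=1..N. (row_sum N A i - 1)\<^sup>2) / real N) < 1 / 2"
  shows "1 / (4 * real N) \<le> max_row_sq N A"
proof -
  have "\<exists>i\<in>{1..N}. 1 / 2 \<le> row_sum N A i"
  proof (rule ccontr)
    assume *: "\<not> ?thesis"
    have "(\<Sum>i=1..N. (1 / 2)\<^sup>2) \<le> (\<Sum>i=1..N. (row_sum N A i - 1)\<^sup>2)"
    proof (rule sum_mono)
      fix i assume "i \<in> {1..N}"
      then have "row_sum N A i < 1 / 2" using * by force
      then have "(1 / 2)\<^sup>2 \<le> (1 - row_sum N A i)\<^sup>2" by (intro power_mono) auto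
      then show "(1 / 2)\<^sup>2 \<le> (row_sum N A i - 1)\<^sup>2" by (simp add: power2_commute)
    qed
    then have "(1 / 2)\<^sup>2 \<le> (\<Sum>i=1..N. (row_sum N A i - 1)\<^sup>2) / real N"
      using N_pos by (simp add: field_simps)
    then have "1 / 2 \<le> sqrt ((\<Sum>i=1..N. (row_sum N A i - 1)\<^sup>2) / real N)"
      by (rule real_le_rsqrt)
    with assms show False by simp
  qed
  then obtain i where i: "i \<in> {1..N}" "1 / 2 \<le> row_sum N A i" by blast
  have "(1 / 2)\<^sup>2 \<le> (row_sum N A i)\<^sup>2"
    using i(2) by (intro power_mono) auto
  also have "\<dots> = (\<Sum>j=1..N. 1 * A i j)\<^sup>2" by (simp add: row_sum_def)
  also have "\<dots> \<le> (\<Sum>j=1..N. 1\<^sup>2) * (\<Sum>j=1..N. (A i j)\<^sup>2)"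
    by (rule Cauchy_Schwarz_ineq_sum)
  also have "\<dots> \<le> real N * max_row_sq N A"
    using row_sq_le_max_row_sq[OF i(1)] by (simp add: mult_left_mono)
  finally show ?thesis
    using N_pos by (simp add: field_simps power2_eq_square)
qed

text \<open>Collects the moment bounds into a rate without logarithms. The condition \<delta> < 1/2
  enters through \<open>max_row_sq_lower_bound\<close>, which makes \<alpha> positive and converts
  the variance error into the term \<open>X\<close>.\<close>

lemma kolmogorov_le:
  fixes z L :: real
  defines "v \<equiv> 1 / (1 - \<beta>)" and "c \<equiv> 4 / gap"
  defines "\<delta> \<equiv> sqrt ((\<Sum>i=1..N. (row_sum N A i - 1)\<^sup>2) / real N)"
  assumes beta: "\<beta> < 1" and \<delta>: "\<delta> < 1 / 2"
    and L1: "4 + 2 / v + (v + 1 / normal_density 0 (sqrt v) 1) / v \<le> L"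
    and L2: "v + 1 / normal_density 0 (sqrt v) 1 \<le> L" and "0 \<le> L"
  shows "\<bar>expect (\<lambda>\<sigma>. of_bool (magn \<sigma> \<le> z)) - cdf (normal_measure 0 v) z\<bar>
    \<le> L * (2 + 4 * sqrt c + 2 * c + 6 * (sqrt c * c)) *
      (1 / sqrt (real N) + (frobenius_norm N A)\<^sup>2 * sqrt (max_row_sq N A) / sqrt (real N) + \<delta>)"
proof -
  define q where "q = sqrt (real N)"
  define \<alpha> where "\<alpha> = max_row_sq N A"
  define X where "X = (frobenius_norm N A)\<^sup>2 * sqrt \<alpha> / q"
  define R where "R = expect (\<lambda>\<sigma>. \<bar>drift_error \<sigma>\<bar>)"
  define W where "W = expect (\<lambda>\<sigma>. \<bar>magn \<sigma>\<bar>)"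
  have q: "1 \<le> q" "q * q = real N" using N_pos by (auto simp: q_def)
  have c: "0 < c" using gap_pos by (simp add: c_def)
  have \<alpha>_lb: "1 / (4 * real N) \<le> \<alpha>"
    unfolding \<alpha>_def using \<delta> unfolding \<delta>_def by (rule max_row_sq_lower_bound)
  moreover have "0 < 1 / (4 * real N)" using N_pos by simp
  ultimately have \<alpha>: "0 < \<alpha>" by linarith
  have \<delta>0: "0 \<le> \<delta>" by (simp add: \<delta>_def sum_nonneg)
  have X0: "0 \<le> X" using \<alpha> q by (simp add: X_def)
  have R: "R \<le> sqrt c * \<delta> + 2 * sqrt c * c * X"
    using expect_abs_drift_error_le[OF beta] \<alpha> by (simp add: R_def c_def \<delta>_def X_def \<alpha>_def q_def)
  have R0: "0 \<le> R" and W0: "0 \<le> W" by (auto simp: R_def W_def intro: expect_nonneg)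
  have W: "W \<le> sqrt c" unfolding W_def c_def by (rule expect_abs_magn_le)
  \<comment> \<open>The variance error has order F^2 / N with F the Frobenius norm. Because 1 / (2
    q) <= sqrt \<alpha>, one of the two factors 1 / q can be traded for 2 * sqrt \<alpha>.\<close>
  have T: "expect mean_sq \<le> 2 * c * X"
  proof -
    have "1 / (2 * q) = sqrt (1 / (4 * real N))"
      by (simp add: q_def real_sqrt_divide real_sqrt_mult)
    also have "\<dots> \<le> sqrt \<alpha>" using \<alpha>_lb by simp
    finally have "(frobenius_norm N A)\<^sup>2 * (1 / (2 * q)) / q \<le> X"
      unfolding X_def using q by (intro divide_right_mono mult_left_mono) auto
    moreover have "(frobenius_norm N A)\<^sup>2 * (1 / (2 * q)) / q = (frobenius_norm N A)\<^sup>2 / real N / 2"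
      unfolding q(2)[symmetric] by simp
    ultimately have "(frobenius_norm N A)\<^sup>2 / real N / 2 \<le> X" by (simp only:)
    then have "(frobenius_norm N A)\<^sup>2 / real N \<le> 2 * X" by (simp only: divide_le_eq_numeral1 mult.commute)
    then have "c * ((frobenius_norm N A)\<^sup>2 / real N) \<le> c * (2 * X)"
      using c by (intro mult_left_mono) auto
    then show ?thesis using expect_mean_sq_le[OF beta] by (simp add: c_def)
  qed
  have iq: "0 \<le> 1 / q" "1 / q \<le> 1" using q by auto
  have "\<bar>expect (\<lambda>\<sigma>. of_bool (magn \<sigma> \<le> z)) - cdf (normal_measure 0 v) z\<bar>
    \<le> L * (R + expect mean_sq + 2 / q * (1 + W) + 2 / q * ((1 - \<beta>) * W + R))"
    unfolding R_def W_def q_def v_def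
    by (rule kolmogorov_le_moments[OF beta L1[unfolded v_def] L2[unfolded v_def]])
  also have "\<dots> \<le> L * ((2 + 4 * sqrt c + 2 * c + 6 * (sqrt c * c)) * (1 / q + X + \<delta>))"
  proof (rule mult_left_mono[OF _ \<open>0 \<le> L\<close>])
    have h1: "1 / q * (1 + W) \<le> 1 / q * (1 + sqrt c)"
      using W iq by (intro mult_left_mono) auto
    have h2: "1 / q * ((1 - \<beta>) * W + R) \<le> 1 / q * sqrt c + R"
    proof -
      have "(1 - \<beta>) * W \<le> 1 * W" using beta_pos W0 by (intro mult_right_mono) auto
      then have "1 / q * ((1 - \<beta>) * W) \<le> 1 / q * sqrt c"
        using W iq by (intro mult_left_mono) auto
      moreover have "1 / q * R \<le> 1 * R" using iq R0 by (intro mult_right_mono)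
      ultimately show ?thesis by (simp add: distrib_left)
    qed
    have "R + expect mean_sq + 2 / q * (1 + W) + 2 / q * ((1 - \<beta>) * W + R)
      = R + expect mean_sq + 2 * (1 / q * (1 + W)) + 2 * (1 / q * ((1 - \<beta>) * W + R))"
      by simp
    also have "\<dots> \<le> R + 2 * c * X + 2 * (1 / q * (1 + sqrt c)) + 2 * (1 / q * sqrt c + R)"
      by (intro add_mono mult_left_mono h1 h2 T order_refl) auto
    \<comment> \<open>\<open>R\<close> occurs once as the drift error and twice more from the
      discretization error, where 1 / q was bounded by 1; hence the coefficient 6 in the
      constant.\<close>
    also have "\<dots> = 3 * R + 2 * c * X + (2 + 4 * sqrt c) * (1 / q)"
      by (simp add: algebra_simps add_divide_distrib)
    also have "\<dots> \<le> 3 * (sqrt c * \<delta> + 2 * sqrt c * c * X) + 2 * c * X + (2 + 4 * sqrt c) * (1 / q)"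
      by (intro add_right_mono mult_left_mono R) auto
    also have "\<dots> \<le> (2 + 4 * sqrt c + 2 * c + 6 * (sqrt c * c)) * (1 / q + X + \<delta>)"
    proof -
      have "(2 + 4 * sqrt c + 2 * c + 6 * (sqrt c * c)) * (1 / q + X + \<delta>)
        - (3 * (sqrt c * \<delta> + 2 * sqrt c * c * X) + 2 * c * X + (2 + 4 * sqrt c) * (1 / q))
        = (2 * c + 6 * (sqrt c * c)) * (1 / q) + (2 + 4 * sqrt c) * X
          + (2 + sqrt c + 2 * c + 6 * (sqrt c * c)) * \<delta>"
        by (simp add: algebra_simps)
      moreover have "0 \<le> \<dots>"
        using c iq X0 \<delta>0 by (intro add_nonneg_nonneg mult_nonneg_nonneg) auto
      ultimately show ?thesis by argo
    qed
    finally show "R + expect mean_sq + 2 / q * (1 + W) + 2 / q * ((1 - \<beta>) * W + R)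
      \<le> (2 + 4 * sqrt c + 2 * c + 6 * (sqrt c * c)) * (1 / q + X + \<delta>)" .
  qed
  finally show ?thesis
    by (simp only: X_def \<alpha>_def q_def mult.assoc)
qed

end

section \<open>The Berry--Esseen bound\<close>

lemma cdf_magnetization:
  "cdf (distr (measure_pmf (ising_pmf N A \<beta> 0)) borel (\<lambda>\<sigma>. sqrt (real N) * spin_mean N \<sigma>)) z
    = measure_pmf.prob (ising_pmf N A \<beta> 0) {\<sigma>. (\<Sum>i=1..N. \<sigma> i) / sqrt (real N) \<le> z}"
proof -
  have "sqrt (real N) * spin_mean N \<sigma> = (\<Sum>i=1..N. \<sigma> i) / sqrt (real N)" for \<sigma>
    by (cases "N = 0") (simp_all add: spin_mean_def field_simps)
  then show ?thesis
    by (simp add: cdf_def2 measure_distr vimage_def)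
qed

lemma d_KS_le:
  assumes "\<And>z. \<bar>cdf \<mu> z - cdf \<nu> z\<bar> \<le> c"
  shows "d_KS \<mu> \<nu> \<le> c"
  unfolding d_KS_def using assms by (intro cSUP_least) auto

theorem theorem1p4:
  fixes \<beta> :: real and A :: "nat \<Rightarrow> nat \<Rightarrow> nat \<Rightarrow> real"
  assumes "0 < \<beta>" and "\<beta> < 1"
    and "\<And>N. N \<ge> 1 \<Longrightarrow> coupling_matrix N (A N)"
    and "(\<lambda>N. MAX i\<in>{1..N}. row_sum N (A N) i) \<longlonglongrightarrow> 1"
  shows "\<exists>C::real. \<forall>N\<ge>1.
    d_KS (distr (measure_pmf (ising_pmf N (A N) \<beta> 0)) borel (\<lambda>\<sigma>. sqrt (real N) * spin_mean N \<sigma>))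
         (normal_measure 0 (1 / (1 - \<beta>)))
    \<le> C * (1 / sqrt (real N)
        + (frobenius_norm N (A N))\<^sup>2 * sqrt (max_row_sq N (A N) * ln (real N)) / sqrt (real N)
        + (1 + frobenius_norm N (A N) * max_row_sq N (A N) * ln (real N))
          * sqrt ((\<Sum>i=1..N. (row_sum N (A N) i - 1)\<^sup>2) / real N))"
proof -
  define v where "v = 1 / (1 - \<beta>)"
  \<comment> \<open>The midpoint of 1 and 1 / \<beta>: above the limit of the maximal row sums, yet
    with \<beta> * \<rho> = (1 + \<beta>) / 2 < 1.\<close>
  define \<rho> where "\<rho> = (1 + 1 / \<beta>) / 2"
  define c where "c = 4 / (1 - \<beta> * \<rho>)"
  define M where "M = v + 1 / normal_density 0 (sqrt v) 1"
  define L where "L = (4 + 2 / v + M / v) + M"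
  define C\<^sub>0 where "C\<^sub>0 = L * (2 + 4 * sqrt c + 2 * c + 6 * (sqrt c * c))"
  have \<beta>: "0 < \<beta>" "\<beta> < 1" by fact+
  have v: "0 < v" using \<beta> by (simp add: v_def)
  have M: "0 \<le> M" using v normal_density_pos[of "sqrt v" 0 1] by (simp add: M_def)
  have L: "4 + 2 / v + M / v \<le> L" "M \<le> L" "0 \<le> L"
    using v M by (simp_all add: L_def)
  have \<rho>: "1 < \<rho>" "\<beta> * \<rho> < 1" using \<beta> by (simp_all add: \<rho>_def field_simps)
  have C\<^sub>0: "0 \<le> C\<^sub>0" using L \<rho> by (simp add: C\<^sub>0_def c_def)
  obtain N\<^sub>0 where N\<^sub>0: "\<And>N. N \<ge> N\<^sub>0 \<Longrightarrow> (MAX i\<in>{1..N}. row_sum N (A N) i) < \<rho>"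
    using order_tendstoD(2)[OF assms(4) \<rho>(1)] by (auto simp: eventually_sequentially)
  \<comment> \<open>One summand for each regime: \<open>C\<^sub>0\<close> for large \<open>N\<close>
    with \<delta> < 1/2, 2 for \<delta> >= 1/2, and the square root for small \<open>N\<close>. In
    the last two the distance is only bounded by 1.\<close>
  define C where "C = C\<^sub>0 + 2 + sqrt (real N\<^sub>0 + 3)"
  show ?thesis
  proof (intro exI[of _ C] allI impI)
    fix N :: nat assume N: "1 \<le> N"
    define \<alpha> where "\<alpha> = max_row_sq N (A N)"
    define F where "F = frobenius_norm N (A N)"
    define \<delta> where "\<delta> = sqrt ((\<Sum>i=1..N. (row_sum N (A N) i - 1)\<^sup>2) / real N)"
    define \<mu> where "\<mu> = distr (measure_pmf (ising_pmf N (A N) \<beta> 0)) borel (\<lambda>\<sigma>. sqrt (real N) * spin_mean N \<sigma>)"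
    define \<nu> where "\<nu> = normal_measure 0 v"
    interpret \<nu>: real_distribution \<nu>
      unfolding \<nu>_def by (rule real_distribution_normal_measure[OF v])
    interpret \<mu>: prob_space \<mu>
      unfolding \<mu>_def by (intro prob_space.prob_space_distr prob_space_measure_pmf) simp
    interpret \<mu>: real_distribution \<mu>
      by standard (simp_all add: \<mu>_def)
    have F: "0 \<le> F" by (simp add: F_def frobenius_norm_def sum_nonneg)
    have "(\<Sum>j=1..N. (A N 1 j)\<^sup>2) \<le> \<alpha>"
      unfolding \<alpha>_def max_row_sq_def using N by (intro Max_ge) auto
    then have \<alpha>: "0 \<le> \<alpha>" by (rule order_trans[rotated]) (simp add: sum_nonneg)
    have \<delta>: "0 \<le> \<delta>" by (simp add: \<delta>_def sum_nonneg)
    have ln: "0 \<le> ln (real N)" using N by simp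
    define X where "X = F\<^sup>2 * sqrt (\<alpha> * ln (real N)) / sqrt (real N)"
    have X: "0 \<le> X" using \<alpha> ln by (simp add: X_def)
    have iN: "0 \<le> 1 / sqrt (real N)" by simp
    define E where "E = 1 / sqrt (real N) + X + (1 + F * \<alpha> * ln (real N)) * \<delta>"
    have E: "1 / sqrt (real N) + X + \<delta> \<le> E"
      \<comment> \<open>The bracket multiplying \<delta> is at least 1.\<close>
      using F \<alpha> ln \<delta> by (simp add: E_def distrib_right)
    have C: "0 \<le> C" using C\<^sub>0 by (simp add: C_def)
    have trivial: "d_KS \<mu> \<nu> \<le> 1"
    proof (rule d_KS_le)
      show "\<bar>cdf \<mu> z - cdf \<nu> z\<bar> \<le> 1" for z
        using \<mu>.cdf_nonneg[of z] \<mu>.cdf_bounded_prob[of z] \<nu>.cdf_nonneg[of z] \<nu>.cdf_bounded_prob[of z]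
        by linarith
    qed
    have "d_KS \<mu> \<nu> \<le> C * (1 / sqrt (real N) + X + \<delta>)"
    \<comment> \<open>From \<open>N\<^sub>0\<close> on all row sums are below \<rho>, and N >= 3 > e
      makes ln N at least 1, so the logarithm can be inserted into \<open>X\<close> at no
      cost.\<close>
    proof (cases "N < N\<^sub>0 + 3")
      case True
      then have "sqrt (real N) \<le> sqrt (real N\<^sub>0 + 3)" by simp
      also have "\<dots> \<le> C" using C\<^sub>0 by (simp add: C_def)
      finally have "1 \<le> C * (1 / sqrt (real N))" using N by simp
      also have "\<dots> \<le> C * (1 / sqrt (real N) + X + \<delta>)"
        using X \<delta> C by (intro mult_left_mono) auto
      finally show ?thesis using trivial by linarith
    next
      case large: False
      show ?thesis
      proof (cases "\<delta> < 1 / 2")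
        case False
        have "1 \<le> 2 * \<delta>" using False by simp
        also have "\<dots> \<le> C * (1 / sqrt (real N) + X + \<delta>)"
          using X \<delta> iN C C\<^sub>0 by (intro mult_mono) (auto simp: C_def)
        finally show ?thesis using trivial by linarith
      next
        case True
        interpret ising: subcritical_ising N "A N" \<beta> \<rho>
        proof
          show "row_sum N (A N) i \<le> \<rho>" if "i \<in> {1..N}" for i
          proof -
            have "row_sum N (A N) i \<le> (MAX i\<in>{1..N}. row_sum N (A N) i)"
              using that by (intro Max_ge) auto
            also have "\<dots> < \<rho>" using large by (intro N\<^sub>0) simp
            finally show ?thesis by simp
          qed
        qed (use N assms(3) \<beta> \<rho> in auto)
        have "exp 1 \<le> real N"
          using exp_le large by linarith
        then have "ln (exp 1) \<le> ln (real N)"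
          using N by (subst ln_le_cancel_iff) auto
        then have "F\<^sup>2 * sqrt \<alpha> / sqrt (real N) \<le> X"
          unfolding X_def using \<alpha> by (intro divide_right_mono mult_left_mono) (auto simp: mult_le_cancel_left1)
        then have le: "C\<^sub>0 * (1 / sqrt (real N) + F\<^sup>2 * sqrt \<alpha> / sqrt (real N) + \<delta>)
            \<le> C\<^sub>0 * (1 / sqrt (real N) + X + \<delta>)"
          using C\<^sub>0 by (intro mult_left_mono) auto
        have "d_KS \<mu> \<nu> \<le> C\<^sub>0 * (1 / sqrt (real N) + X + \<delta>)"
        proof (rule d_KS_le, rule order_trans[OF _ le])
          fix z
          have "cdf \<mu> z = ising.expect (\<lambda>\<sigma>. of_bool (ising.magn \<sigma> \<le> z))"
            unfolding \<mu>_def cdf_magnetization ising.magn_def by (rule ising.prob_ising_pmf_eq_expect)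
          then show "\<bar>cdf \<mu> z - cdf \<nu> z\<bar> \<le> C\<^sub>0 * (1 / sqrt (real N) + F\<^sup>2 * sqrt \<alpha> / sqrt (real N) + \<delta>)"
            using ising.kolmogorov_le[of L z] \<beta> True L
            by (simp only: \<nu>_def v_def M_def C\<^sub>0_def c_def ising.gap_def F_def \<alpha>_def \<delta>_def)
        qed
        also have "\<dots> \<le> C * (1 / sqrt (real N) + X + \<delta>)"
          using X \<delta> iN by (intro mult_right_mono) (auto simp: C_def)
        finally show ?thesis .
      qed
    qed
    also have "\<dots> \<le> C * E" using E C by (rule mult_left_mono)
    finally show "d_KS (distr (measure_pmf (ising_pmf N (A N) \<beta> 0)) borel (\<lambda>\<sigma>. sqrt (real N) * spin_mean N \<sigma>))
         (normal_measure 0 (1 / (1 - \<beta>)))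
      \<le> C * (1 / sqrt (real N)
        + (frobenius_norm N (A N))\<^sup>2 * sqrt (max_row_sq N (A N) * ln (real N)) / sqrt (real N)
        + (1 + frobenius_norm N (A N) * max_row_sq N (A N) * ln (real N))
          * sqrt ((\<Sum>i=1..N. (row_sum N (A N) i - 1)\<^sup>2) / real N))"
      by (simp only: E_def X_def F_def \<alpha>_def \<delta>_def \<mu>_def \<nu>_def v_def)
  qed
qed

end
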